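(* Let $(Q,\mathfrak m_Q,\mathsf k)$ be a Gorenstein Artin local ring with $\operatorname{edim}(Q)=d$. If for some $i\geq 2$ one has $H_Q(i)\geq\binom{d-2+i}{i}+2$, then $Q$ is indecomposable as a connected sum over $\mathsf k$.
   Context: $\operatorname{edim}(T)$ is the minimal number of generators of the maximal ideal of a local ring $T$. The Hilbert function of $(Q,\mathfrak m_Q,\mathsf k)$ is $H_Q(i)=\dim_{\mathsf k}(\mathfrak m_Q^i/\mathfrak m_Q^{i+1})$. Fibre product: for local rings $(R,\mathfrak m_R,\mathsf k)$, $(S,\mathfrak m_S,\mathsf k)$ with natural projections $\pi_R,\pi_S$ onto $\mathsf k$, $R\times_{\mathsf k}S=\{(r,s)\in R\times S:\pi_R(r)=\pi_S(s)\}$. Connected sum: if $R,S$ are Gorenstein Artin local rings with residue field $\mathsf k$, different from $\mathsf k$, and $\operatorname{soc}(R)=\langle\delta_R\rangle$, $\operatorname{soc}(S)=\langle\delta_S\rangle$ (where $\operatorname{soc}(T)$ is the annihilator of the maximal ideal of $T$), then a connected sum of $R$ and $S$ over $\mathsf k$ is $R\#_{\mathsf k}S=(R\times_{\mathsf k}S)/\langle(\delta_R,0)-(0,\delta_S)\rangle$. It depends on the chosen socle generators; $Q\simeq R\#_{\mathsf k}S$ means that this holds for some choice. A Gorenstein Artin local ring $(Q,\mathfrak m_Q,\mathsf k)$ decomposes as a connected sum over $\mathsf k$ if there exist Gorenstein Artin local rings $R$ and $S$ such that $Q\simeq R\#_{\mathsf k}S$ and $R\not\simeq Q\not\simeq S$.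 Otherwise $Q$ is indecomposable as a connected sum over $\mathsf k$.
   Formalization: Decompositions only count if each component R, S with square-zero maximal ideal contains a coefficient field; otherwise the claim fails: Z/p² # F_p[x,y]/(x³,y³) has H = 1,2,3,2,1 and d = 2, meets the bound at i = 2, and is isomorphic to neither component. *)

theory Defs
  imports "HOL-Algebra.Algebra" "Jordan_Normal_Form.Missing_VectorSpace"
begin

definition local_ring :: "('a, 'm) ring_scheme \<Rightarrow> bool"
  where "local_ring R \<longleftrightarrow> cring R \<and> (\<exists>!\<mm>. maximalideal \<mm> R)"

definition max_ideal :: "('a, 'm) ring_scheme \<Rightarrow> 'a set"
  where "max_ideal R = (THE \<mm>. maximalideal \<mm> R)"

definition residue_field :: "('a, 'm) ring_scheme \<Rightarrow> 'a set ring"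
  where "residue_field R = R Quot max_ideal R"

definition max_ideal_power :: "('a, 'm) ring_scheme \<Rightarrow> nat \<Rightarrow> 'a set"
  where "max_ideal_power R i = max_ideal R [^]\<^bsub>ideals_set R\<^esub> i"

definition artinian_ring :: "('a, 'm) ring_scheme \<Rightarrow> bool"
  where "artinian_ring R \<longleftrightarrow> ring R \<and>
    (\<forall>I :: nat \<Rightarrow> 'a set. (\<forall>n. ideal (I n) R) \<and> (\<forall>n. I (Suc n) \<subseteq> I n)
      \<longrightarrow> (\<exists>N. \<forall>n\<ge>N. I n = I N))"

text \<open>For ideals \<open>J \<subseteq> I\<close> with \<open>\<mm> I \<subseteq> J\<close>, the quotient \<open>I / J\<close> as a vector space over the
  residue field.  The coset of \<open>r\<close> modulo \<open>\<mm>\<close> sends the coset of \<open>x\<close> modulo \<open>J\<close> to the coset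
  of \<open>r x\<close>.  The fields \<open>mult\<close> and \<open>one\<close> of the record play no role in a module.\<close>

definition subquotient :: "('a, 'm) ring_scheme \<Rightarrow> 'a set \<Rightarrow> 'a set \<Rightarrow> ('a set, 'a set) module"
  where "subquotient R I J =
    \<lparr> carrier = (\<lambda>x. J +>\<^bsub>R\<^esub> x) ` I,
      monoid.mult = undefined, monoid.one = undefined,
      ring.zero = J, ring.add = set_add R,
      smult = rcoset_mult R J \<rparr>"

definition hilbert_function :: "('a, 'm) ring_scheme \<Rightarrow> nat \<Rightarrow> nat"
  where "hilbert_function R i = vectorspace.dim (residue_field R)
    (subquotient R (max_ideal_power R i) (max_ideal_power R (Suc i)))"

definition edim :: "('a, 'm) ring_scheme \<Rightarrow> nat"
  where "edim R = (LEAST n. \<exists>A. A \<subseteq> carrier R \<and> finite A \<and> card A = n \<and> Idl\<^bsub>R\<^esub> A = max_ideal R)"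

definition socle :: "('a, 'm) ring_scheme \<Rightarrow> 'a set"
  where "socle R = {x \<in> carrier R. \<forall>y \<in> max_ideal R. y \<otimes>\<^bsub>R\<^esub> x = \<zero>\<^bsub>R\<^esub>}"

text \<open>An Artin local ring is Cohen--Macaulay of depth zero, so it is Gorenstein if and only if its
  type, the dimension of its socle over the residue field, is one.  A field is Gorenstein.\<close>

definition gorenstein_artin_local_ring :: "('a, 'm) ring_scheme \<Rightarrow> bool"
  where "gorenstein_artin_local_ring R \<longleftrightarrow> local_ring R \<and> artinian_ring R \<and>
    vectorspace.fin_dim (residue_field R) (subquotient R (socle R) {\<zero>\<^bsub>R\<^esub>}) \<and>
    vectorspace.dim (residue_field R) (subquotient R (socle R) {\<zero>\<^bsub>R\<^esub>}) = 1"

text \<open>A local ring \<open>(R, \<mm>, k)\<close> comes with a natural projection \<open>\<pi>\<close> onto \<open>k\<close>.  As \<open>k\<close> is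
  a field, the kernel of a surjection onto \<open>k\<close> is the maximal ideal.\<close>

definition residue_projection ::
  "('a, 'm) ring_scheme \<Rightarrow> ('k, 'n) ring_scheme \<Rightarrow> ('a \<Rightarrow> 'k) \<Rightarrow> bool"
  where "residue_projection R k \<pi> \<longleftrightarrow> \<pi> \<in> ring_hom R k \<and> \<pi> ` carrier R = carrier k"

definition fibre_product ::
  "('a, 'm) ring_scheme \<Rightarrow> ('b, 'n) ring_scheme \<Rightarrow> ('a \<Rightarrow> 'k) \<Rightarrow> ('b \<Rightarrow> 'k) \<Rightarrow> ('a \<times> 'b) ring"
  where "fibre_product R S \<pi>\<^sub>R \<pi>\<^sub>S =
    (RDirProd R S) \<lparr> carrier := {(r, s). r \<in> carrier R \<and> s \<in> carrier S \<and> \<pi>\<^sub>R r = \<pi>\<^sub>S s} \<rparr>"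

definition connected_sum ::
  "('a, 'm) ring_scheme \<Rightarrow> ('b, 'n) ring_scheme \<Rightarrow> ('a \<Rightarrow> 'k) \<Rightarrow> ('b \<Rightarrow> 'k) \<Rightarrow> 'a \<Rightarrow> 'b
    \<Rightarrow> ('a \<times> 'b) set ring"
  where "connected_sum R S \<pi>\<^sub>R \<pi>\<^sub>S \<delta>\<^sub>R \<delta>\<^sub>S =
    (let P = fibre_product R S \<pi>\<^sub>R \<pi>\<^sub>S
     in P Quot (PIdl\<^bsub>P\<^esub> ((\<delta>\<^sub>R, \<zero>\<^bsub>S\<^esub>) \<ominus>\<^bsub>P\<^esub> (\<zero>\<^bsub>R\<^esub>, \<delta>\<^sub>S))))"

definition is_connected_sum ::
  "('q, 'l) ring_scheme \<Rightarrow> ('a, 'm) ring_scheme \<Rightarrow> ('b, 'n) ring_scheme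
    \<Rightarrow> ('a \<Rightarrow> 'k) \<Rightarrow> ('b \<Rightarrow> 'k) \<Rightarrow> bool"
  where "is_connected_sum Q R S \<pi>\<^sub>R \<pi>\<^sub>S \<longleftrightarrow>
    (\<exists>\<delta>\<^sub>R \<in> carrier R. \<exists>\<delta>\<^sub>S \<in> carrier S.
       socle R = PIdl\<^bsub>R\<^esub> \<delta>\<^sub>R \<and> socle S = PIdl\<^bsub>S\<^esub> \<delta>\<^sub>S \<and>
       Q \<simeq> connected_sum R S \<pi>\<^sub>R \<pi>\<^sub>S \<delta>\<^sub>R \<delta>\<^sub>S)"

text \<open>A component of length two (that is, with \<open>\<mm>\<^sup>2 = 0\<close>) is meant to be \<open>k[x]/(x\<^sup>2)\<close>, so to
  contain a coefficient field.  Such a component never gives a nontrivial decomposition: if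
  \<open>R = k[x]/(x\<^sup>2)\<close> then \<open>R #\<^sub>k S \<simeq> S\<close>.  In mixed characteristic this fails:
  \<open>\<int>/p\<^sup>2\<close> is also Gorenstein of length two, and its connected sum with
  \<open>F\<^sub>p[x,y]/(x\<^sup>3,y\<^sup>3)\<close> is \<open>\<int>[x,y]/(p - x\<^sup>2y\<^sup>2, x\<^sup>3, y\<^sup>3)\<close>, isomorphic to neither of the two.
  Its Hilbert function is \<open>1,2,3,2,1\<close>, the same as that of \<open>F\<^sub>p[x,y]/(x\<^sup>3,y\<^sup>3)\<close>.  The condition
  below excludes these degenerate components and no others: by Cohen's structure theorem it holds
  automatically in equal characteristic, and it is void if \<open>\<mm>\<^sup>2 \<noteq> 0\<close>.\<close>

definition nondegenerate_component ::
  "('a, 'm) ring_scheme \<Rightarrow> ('k, 'n) ring_scheme \<Rightarrow> ('a \<Rightarrow> 'k) \<Rightarrow> bool"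
  where "nondegenerate_component R k \<pi> \<longleftrightarrow>
    (max_ideal_power R 2 = {\<zero>\<^bsub>R\<^esub>} \<longrightarrow>
      (\<exists>\<sigma> \<in> ring_hom k R. \<forall>c \<in> carrier k. \<pi> (\<sigma> c) = c))"

text \<open>HOL cannot quantify over the carrier types \<open>'a\<close>, \<open>'b\<close> of the components inside a formula, so
  they are parameters; a theorem in which they are type variables speaks about all rings.\<close>

definition decomposes_as_connected_sum ::
  "'a itself \<Rightarrow> 'b itself \<Rightarrow> ('q, 'l) ring_scheme \<Rightarrow> bool"
  where "decomposes_as_connected_sum _ _ Q \<longleftrightarrow>
    (\<exists>(R :: 'a ring) (S :: 'b ring) \<pi>\<^sub>R \<pi>\<^sub>S.
       gorenstein_artin_local_ring R \<and> gorenstein_artin_local_ring S \<and>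
       residue_projection R (residue_field Q) \<pi>\<^sub>R \<and> residue_projection S (residue_field Q) \<pi>\<^sub>S \<and>
       \<not> R \<simeq> residue_field Q \<and> \<not> S \<simeq> residue_field Q \<and>
       nondegenerate_component R (residue_field Q) \<pi>\<^sub>R \<and>
       nondegenerate_component S (residue_field Q) \<pi>\<^sub>S \<and>
       is_connected_sum Q R S \<pi>\<^sub>R \<pi>\<^sub>S \<and>
       \<not> R \<simeq> Q \<and> \<not> Q \<simeq> S)"

definition indecomposable_as_connected_sum ::
  "'a itself \<Rightarrow> 'b itself \<Rightarrow> ('q, 'l) ring_scheme \<Rightarrow> bool"
  where "indecomposable_as_connected_sum A B Q \<longleftrightarrow> \<not> decomposes_as_connected_sum A B Q"

end

theory Submission
  imports Defs
begin

text \<open>Let \<open>Q = R #\<^sub>k S\<close> with \<open>d = edim Q\<close>, and let \<open>I\<close> and \<open>L\<close> be the images in \<open>Q\<close> of the maximal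
ideals of \<open>R\<close> and \<open>S\<close>.  Then \<open>I + L\<close> is the maximal ideal \<open>\<mm>\<close> of \<open>Q\<close> and \<open>I L = 0\<close>.  By Steinitz
exchange in \<open>\<mm> / \<mm>\<^sup>2\<close>, the ideal \<open>\<mm>\<close> is generated by \<open>r\<close> elements of \<open>I\<close> and \<open>s\<close> elements of \<open>L\<close> with
\<open>r + s \<le> d\<close>.  As the mixed monomials vanish, \<open>\<mm>\<^sup>i\<close> is generated by the monomials of degree \<open>i\<close> in the
first \<open>r\<close> elements together with those in the other \<open>s\<close> elements.  Therefore
\[ H_Q(i) \le {r+i-1 \choose i} + {s+i-1 \choose i} . \]
The right-hand side is convex in \<open>(r, s)\<close>, so for \<open>r, s \<ge> 1\<close> it is largest when one of the two numbers
is \<open>1\<close>, and then it is at most ${d+i-2 \choose i} + 1$.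

It remains to exclude \<open>r = 0\<close> and, by symmetry, \<open>s = 0\<close>.  If \<open>r = 0\<close>, then \<open>\<mm>\<close> is generated by elements
of \<open>L\<close>, all of which annihilate \<open>I\<close>, so \<open>I I = 0\<close>.  The ideal that is divided out of the fibre product
meets \<open>R \<times> 0\<close> trivially, so the maximal ideal of \<open>R\<close> has square zero and equals the socle of \<open>R\<close>.  By
nondegeneracy \<open>R\<close> contains a coefficient field \<open>\<sigma>(k)\<close>, and then \<open>s \<mapsto> (\<sigma>(\<pi>\<^sub>S s), s)\<close> induces an
isomorphism from \<open>S\<close> to \<open>Q\<close>: the decomposition is trivial.

The bound is \<open>hilbert_function_le_if_orthogonal_generators\<close>; it rests on \<open>exchange_generators\<close> and
\<open>max_ideal_power_eq_genideal_monomials\<close>.  The degenerate case is \<open>iso_if_square_zero\<close>.  The number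
\<open>edim Q\<close> is a minimum over finite generating sets, so \<open>ex_finite_generators\<close> is needed to know that it
is attained.\<close>

section \<open>Ideals of commutative rings\<close>

lemma (in cring) cring_idealI:
  assumes "I \<subseteq> carrier R" "\<zero> \<in> I"
    and "\<And>x y. x \<in> I \<Longrightarrow> y \<in> I \<Longrightarrow> x \<oplus> y \<in> I"
    and "\<And>a x. a \<in> carrier R \<Longrightarrow> x \<in> I \<Longrightarrow> a \<otimes> x \<in> I"
  shows "ideal I R"
proof (rule idealI[OF ring_axioms])
  show "subgroup I (add_monoid R)"
  proof (rule add.subgroupI)
    fix x assume x: "x \<in> I"
    have "\<ominus> x = (\<ominus> \<one>) \<otimes> x" using x assms(1) by (simp add: l_minus subsetD)
    then show "\<ominus> x \<in> I" using assms(4) x by simp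
  qed (use assms in auto)
  show "x \<otimes> a \<in> I" if "a \<in> I" "x \<in> carrier R" for a x using assms(4) that by auto
  show "a \<otimes> x \<in> I" if "a \<in> I" "x \<in> carrier R" for a x
    using assms(1,4) that m_comm[of a x] by auto
qed

text \<open>Conditions of the form \<open>S z \<subseteq> J\<close> can be tested on generators of an ideal.  This replaces the expansion
of the elements of a generated ideal as linear combinations.\<close>

lemma (in cring) ideal_colon:
  assumes "ideal J R" "S \<subseteq> carrier R"
  shows "ideal {z \<in> carrier R. \<forall>s\<in>S. s \<otimes> z \<in> J} R"
proof (rule cring_idealI)
  interpret J: ideal J R by fact
  show "\<zero> \<in> {z \<in> carrier R. \<forall>s\<in>S. s \<otimes> z \<in> J}"
    using assms(2) by auto
  fix x y a
  assume x: "x \<in> {z \<in> carrier R. \<forall>s\<in>S. s \<otimes> z \<in> J}"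
  show "x \<oplus> y \<in> {z \<in> carrier R. \<forall>s\<in>S. s \<otimes> z \<in> J}"
    if y: "y \<in> {z \<in> carrier R. \<forall>s\<in>S. s \<otimes> z \<in> J}"
    using x y assms(2) by (auto simp: r_distr subset_iff)
  show "a \<otimes> x \<in> {z \<in> carrier R. \<forall>s\<in>S. s \<otimes> z \<in> J}" if a: "a \<in> carrier R"
  proof -
    have "s \<otimes> (a \<otimes> x) \<in> J" if s: "s \<in> S" for s
    proof -
      have "s \<otimes> (a \<otimes> x) = a \<otimes> (s \<otimes> x)" using s x a assms(2) m_lcomm by blast
      then show ?thesis using s x a J.I_l_closed by auto
    qed
    then show ?thesis using a x by auto
  qed
qed auto

text \<open>A colon ideal is used twice, once for each factor.\<close>

lemma (in cring) genideal_mult_mem: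
  assumes "ideal J R" "A \<subseteq> carrier R" "B \<subseteq> carrier R"
    and AB: "\<And>a b. a \<in> A \<Longrightarrow> b \<in> B \<Longrightarrow> a \<otimes> b \<in> J"
    and "x \<in> Idl A" "y \<in> Idl B"
  shows "x \<otimes> y \<in> J"
proof -
  have carr: "Idl A \<subseteq> carrier R" "Idl B \<subseteq> carrier R"
    using assms(2,3) by (intro genideal_minimal oneideal; simp)+
  have "Idl B \<subseteq> {z \<in> carrier R. \<forall>s\<in>A. s \<otimes> z \<in> J}"
    by (rule genideal_minimal[OF ideal_colon]) (use assms in auto)
  then have B: "a \<otimes> b \<in> J" if "a \<in> A" "b \<in> Idl B" for a b using that by blast
  have "Idl A \<subseteq> {z \<in> carrier R. \<forall>s\<in>Idl B. s \<otimes> z \<in> J}"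
  proof (rule genideal_minimal[OF ideal_colon[OF assms(1) carr(2)]], rule subsetI)
    fix a assume a: "a \<in> A"
    have "b \<otimes> a \<in> J" if "b \<in> Idl B" for b
    proof -
      have "b \<otimes> a = a \<otimes> b" using a that assms(2) carr(2) by (intro m_comm) auto
      then show ?thesis using B[OF a that] by simp
    qed
    then show "a \<in> {z \<in> carrier R. \<forall>s\<in>Idl B. s \<otimes> z \<in> J}" using a assms(2) by blast
  qed
  then have "y \<otimes> x \<in> J" using assms(5,6) by blast
  moreover have "x \<otimes> y = y \<otimes> x" using assms(5,6) carr by (intro m_comm) auto
  ultimately show ?thesis by simp
qed

lemma (in cring) ideal_prod_subset:
  assumes "ideal J R" and "\<And>x y. x \<in> I \<Longrightarrow> y \<in> K \<Longrightarrow> x \<otimes> y \<in> J"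
  shows "I \<cdot> K \<subseteq> J"
proof
  fix z assume "z \<in> I \<cdot> K"
  then show "z \<in> J"
    by (induct z rule: ideal_prod.induct)
      (use assms in \<open>auto simp: additive_subgroup.a_closed ideal.axioms(1)\<close>)
qed

lemma (in cring) add_cgenideal_ideal:
  assumes "ideal K R" "z \<in> carrier R"
  shows "ideal (K <+>\<^bsub>R\<^esub> PIdl z) R" "K \<subseteq> K <+>\<^bsub>R\<^esub> PIdl z" "z \<in> K <+>\<^bsub>R\<^esub> PIdl z"
proof -
  interpret K: ideal K R by fact
  show "ideal (K <+>\<^bsub>R\<^esub> PIdl z) R" using add_ideals[OF assms(1) cgenideal_ideal[OF assms(2)]] .
  have z: "z \<in> PIdl z" "\<zero> \<in> PIdl z"
    using cgenideal_self[OF assms(2)] cgenideal_ideal[OF assms(2)]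
    by (auto simp: additive_subgroup.zero_closed ideal.axioms(1))
  show "K \<subseteq> K <+>\<^bsub>R\<^esub> PIdl z"
  proof
    fix k assume "k \<in> K"
    then have "k = k \<oplus> \<zero>" using K.Icarr by simp
    then show "k \<in> K <+>\<^bsub>R\<^esub> PIdl z" using z \<open>k \<in> K\<close> unfolding set_add_def' by blast
  qed
  have "z = \<zero> \<oplus> z" using assms by simp
  then show "z \<in> K <+>\<^bsub>R\<^esub> PIdl z" using z K.zero_closed unfolding set_add_def' by blast
qed

lemma (in cring) add_cgenideal_memE:
  assumes "x \<in> K <+>\<^bsub>R\<^esub> PIdl z"
  obtains k a where "k \<in> K" "a \<in> carrier R" "x = k \<oplus> a \<otimes> z"
  using assms unfolding set_add_def' cgenideal_def by blast

text \<open>In a local ring, this is how a generator \<open>z\<close> with a unit coefficient is traded for \<open>k \<oplus> a \<otimes> z\<close>.\<close>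

lemma (in cring) unit_coeff_solve:
  assumes "a \<in> Units R" "k \<in> carrier R" "z \<in> carrier R"
  shows "z = (\<ominus> (inv a)) \<otimes> k \<oplus> inv a \<otimes> (k \<oplus> a \<otimes> z)"
proof -
  have c: "a \<in> carrier R" "inv a \<in> carrier R" using assms(1) by auto
  have "(\<ominus> (inv a)) \<otimes> k \<oplus> inv a \<otimes> (k \<oplus> a \<otimes> z) = (inv a \<otimes> a) \<otimes> z"
    using c assms(2,3) by algebra
  then show ?thesis using assms by simp
qed

text \<open>Zorn's lemma.  For \<open>x = \<one>\<close> the ideal \<open>J\<close> is a maximal ideal; for \<open>x\<close> in the maximal ideal \<open>\<mm>\<close> of a
local ring and \<open>I = \<mm>\<^sup>2\<close>, it cuts out a hyperplane of \<open>\<mm> / \<mm>\<^sup>2\<close> that misses \<open>x\<close>.\<close>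

lemma (in cring) ex_ideal_maximal_avoiding:
  assumes "ideal I R" "x \<in> carrier R" "x \<notin> I"
  obtains J where "ideal J R" "I \<subseteq> J" "x \<notin> J" "\<And>K. ideal K R \<Longrightarrow> J \<subset> K \<Longrightarrow> x \<in> K"
proof -
  define F where "F = {J. ideal J R \<and> I \<subseteq> J \<and> x \<notin> J}"
  have "\<exists>M\<in>F. \<forall>K\<in>F. M \<subseteq> K \<longrightarrow> K = M"
  proof (rule subset_Zorn_nonempty)
    show "F \<noteq> {}" using assms by (auto simp: F_def)
    fix C assume C: "C \<noteq> {}" "subset.chain F C"
    then have "subset.chain {I. ideal I R} C" unfolding pred_on.chain_def F_def by auto
    from chain_Union_is_ideal[OF this] C show "\<Union>C \<in> F" unfolding pred_on.chain_def F_def by auto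
  qed
  then obtain M where "M \<in> F" "\<forall>K\<in>F. M \<subseteq> K \<longrightarrow> K = M" by blast
  then show thesis using that[of M] unfolding F_def by blast
qed

section \<open>Local rings\<close>

locale local_cring = cring R for R (structure) +
  assumes ex1_maximalideal: "\<exists>!\<mm>. maximalideal \<mm> R"
begin

abbreviation "\<mm> \<equiv> max_ideal R"
abbreviation "\<mm>pow \<equiv> max_ideal_power R"

lemma maximalideal_max_ideal: "maximalideal \<mm> R"
  using theI'[OF ex1_maximalideal] unfolding max_ideal_def .

sublocale maxi: maximalideal \<mm> R by (rule maximalideal_max_ideal)

lemma one_notin_max_ideal: "\<one> \<notin> \<mm>"
  using maxi.I_notcarr maxi.one_imp_carrier by auto

lemma proper_ideal_subset_max_ideal:
  assumes "ideal I R" "\<one> \<notin> I" shows "I \<subseteq> \<mm>"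
proof -
  obtain J where J: "ideal J R" "I \<subseteq> J" "\<one> \<notin> J" "\<And>K. ideal K R \<Longrightarrow> J \<subset> K \<Longrightarrow> \<one> \<in> K"
    using ex_ideal_maximal_avoiding[OF assms(1) one_closed assms(2)] by metis
  have "maximalideal J R"
  proof (rule maximalidealI[OF J(1)])
    show "carrier R \<noteq> J" using J(3) by auto
    fix K assume K: "ideal K R" "J \<subseteq> K" "K \<subseteq> carrier R"
    then show "K = J \<or> K = carrier R" using J(4)[OF K(1)] ideal.one_imp_carrier by blast
  qed
  then have "J = \<mm>" using ex1_maximalideal maximalideal_max_ideal by blast
  then show ?thesis using J by simp
qed

lemma Units_iff: "x \<in> carrier R \<Longrightarrow> x \<in> Units R \<longleftrightarrow> x \<notin> \<mm>"
proof
  assume "x \<in> carrier R" "x \<notin> \<mm>"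
  then have "\<not> PIdl x \<subseteq> \<mm>" using cgenideal_self by blast
  then have "\<one> \<in> PIdl x"
    using proper_ideal_subset_max_ideal[OF cgenideal_ideal[OF \<open>x \<in> carrier R\<close>]] by blast
  then obtain y where "y \<in> carrier R" "\<one> = y \<otimes> x" unfolding cgenideal_def by blast
  then show "x \<in> Units R" unfolding Units_def using \<open>x \<in> carrier R\<close> m_comm by auto
next
  assume "x \<in> carrier R" "x \<in> Units R"
  show "x \<notin> \<mm>"
  proof
    assume "x \<in> \<mm>"
    then have "inv x \<otimes> x \<in> \<mm>" using maxi.I_l_closed[of x "inv x"] Units_inv_closed[OF \<open>x \<in> Units R\<close>] by blast
    then show False using \<open>x \<in> Units R\<close> one_notin_max_ideal by simp
  qed
qed

text \<open>Nakayama's lemma for a principal ideal: \<open>\<one> \<ominus> y\<close> is a unit that annihilates \<open>x\<close>.\<close>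

lemma eq_zero_if_eq_max_ideal_mult:
  assumes "x \<in> carrier R" "y \<in> \<mm>" "x = y \<otimes> x"
  shows "x = \<zero>"
proof -
  have y: "y \<in> carrier R" using assms(2) maxi.Icarr by auto
  have "\<one> \<ominus> y \<notin> \<mm>"
  proof
    assume "\<one> \<ominus> y \<in> \<mm>"
    then have "(\<one> \<ominus> y) \<oplus> y \<in> \<mm>" using assms(2) by simp
    moreover have "(\<one> \<ominus> y) \<oplus> y = \<one>" using y by algebra
    ultimately show False using one_notin_max_ideal by simp
  qed
  then have u: "\<one> \<ominus> y \<in> Units R" using y Units_iff by simp
  have "(\<one> \<ominus> y) \<otimes> x = x \<ominus> y \<otimes> x" using y assms(1) by algebra
  also have "\<dots> = \<zero>" using assms by (metis r_neg minus_eq)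
  finally have "inv (\<one> \<ominus> y) \<otimes> ((\<one> \<ominus> y) \<otimes> x) = \<zero>" using u by simp
  then show ?thesis using u assms(1) y by (simp add: m_assoc[symmetric])
qed

lemma max_ideal_power_0: "\<mm>pow 0 = carrier R"
  by (simp add: max_ideal_power_def ideals_set_def)

lemma max_ideal_power_Suc: "\<mm>pow (Suc n) = \<mm>pow n \<cdot> \<mm>"
  by (simp add: max_ideal_power_def ideals_set_def)

lemma max_ideal_power_ideal: "ideal (\<mm>pow n) R"
  by (induct n) (simp_all add: max_ideal_power_0 max_ideal_power_Suc oneideal ideal_prod_is_ideal maxi.is_ideal)

lemma max_ideal_power_Suc_subset: "\<mm>pow (Suc n) \<subseteq> \<mm>pow n"
  using ideal_prod_inter[OF max_ideal_power_ideal maxi.is_ideal] unfolding max_ideal_power_Suc by blast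

lemma max_ideal_power_1: "\<mm>pow (Suc 0) = \<mm>"
  unfolding max_ideal_power_Suc max_ideal_power_0
  by (metis ideal_prod_commute ideal_prod_one maxi.is_ideal oneideal)

end

section \<open>Artinian local rings\<close>

lemma artinian_ring_chain_stabilises:
  fixes I :: "nat \<Rightarrow> 'a set"
  assumes "artinian_ring R" "\<And>n. ideal (I n) R" "\<And>n. I (Suc n) \<subseteq> I n"
  shows "\<exists>N. \<forall>n\<ge>N. I n = I N"
proof -
  have "(\<forall>n. ideal (I n) R) \<and> (\<forall>n. I (Suc n) \<subseteq> I n) \<longrightarrow> (\<exists>N. \<forall>n\<ge>N. I n = I N)"
    using assms(1) unfolding artinian_ring_def by simp
  then show ?thesis using assms(2,3) by simp
qed

lemma artinian_ring_minimal_ideal: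
  assumes "artinian_ring R" "F \<noteq> {}" "\<And>I. I \<in> F \<Longrightarrow> ideal I R"
  obtains J where "J \<in> F" "\<And>K. K \<in> F \<Longrightarrow> K \<subseteq> J \<Longrightarrow> K = J"
proof (rule ccontr)
  assume "\<not> thesis"
  then have "\<forall>J\<in>F. \<exists>K\<in>F. K \<subset> J" using that by blast
  then obtain f where f: "\<And>J. J \<in> F \<Longrightarrow> f J \<in> F \<and> f J \<subset> J" by metis
  obtain J0 where "J0 \<in> F" using assms(2) by blast
  define I where "I n = (f ^^ n) J0" for n :: nat
  have I: "I n \<in> F" for n by (induct n) (simp_all add: I_def \<open>J0 \<in> F\<close> f)
  have less: "I (Suc n) \<subset> I n" for n using f[OF I[of n]] by (simp add: I_def)
  have sub: "I (Suc n) \<subseteq> I n" for n using less[of n] by simp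
  have id: "ideal (I n) R" for n by (rule assms(3)[OF I])
  obtain N where N: "\<forall>n\<ge>N. I n = I N"
    using artinian_ring_chain_stabilises[where I = I, OF assms(1) id sub] ..
  have "I (Suc N) = I N" by (rule N[rule_format]) simp
  then show False using less[of N] by simp
qed

locale artinian_local_cring = local_cring +
  assumes artinian: "artinian_ring R"
begin

text \<open>The powers of \<open>\<mm>\<close> stabilise at an ideal \<open>I\<close> with \<open>I \<mm> = I\<close>.  If \<open>I \<noteq> 0\<close>, let \<open>J\<close> be minimal among the
ideals with \<open>J I \<noteq> 0\<close>, and let \<open>x \<in> J\<close> with \<open>x I \<noteq> 0\<close>.  The ideal \<open>x \<mm> \<subseteq> J\<close> satisfies
\<open>(x \<mm>) I = x I \<noteq> 0\<close>, so it is \<open>J\<close>.  Hence \<open>x = a x\<close> for some \<open>a \<in> \<mm>\<close>, which forces \<open>x = 0\<close>.\<close>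

lemma max_ideal_nilpotent: "\<exists>n. \<mm>pow n = {\<zero>}"
proof -
  obtain N where N: "\<forall>n\<ge>N. \<mm>pow n = \<mm>pow N"
    using artinian_ring_chain_stabilises[where I = \<mm>pow, OF artinian max_ideal_power_ideal max_ideal_power_Suc_subset] ..
  define I where "I = \<mm>pow N"
  have I: "ideal I R" and Im: "I \<cdot> \<mm> = I"
    using max_ideal_power_ideal N[rule_format, of "Suc N"] by (simp_all add: I_def max_ideal_power_Suc)
  interpret I: ideal I R by fact
  let ?F = "{J. ideal J R \<and> (\<exists>x\<in>J. \<exists>y\<in>I. x \<otimes> y \<noteq> \<zero>)}"
  have "I = {\<zero>}"
  proof (rule ccontr)
    assume "I \<noteq> {\<zero>}"
    then obtain y where "y \<in> I" "y \<noteq> \<zero>" using I.zero_closed by blast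
    then have "\<one> \<otimes> y \<noteq> \<zero>" "\<one> \<in> carrier R" using I.Icarr by auto
    then have "carrier R \<in> ?F" using oneideal \<open>y \<in> I\<close> by blast
    then obtain J where J: "J \<in> ?F" and min: "\<And>K. K \<in> ?F \<Longrightarrow> K \<subseteq> J \<Longrightarrow> K = J"
      using artinian_ring_minimal_ideal[OF artinian, of ?F] by blast
    then obtain x y where xy: "x \<in> J" "y \<in> I" "x \<otimes> y \<noteq> \<zero>" and idJ: "ideal J R" by blast
    interpret J: ideal J R by fact
    have x: "x \<in> carrier R" using xy J.Icarr by auto
    let ?K = "(PIdl x) \<cdot> \<mm>"
    have K: "ideal ?K R" using ideal_prod_is_ideal[OF cgenideal_ideal[OF x] maxi.is_ideal] .
    have "\<exists>a\<in>\<mm>. z = a \<otimes> x" if "z \<in> ?K" for z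
      using that
    proof (induct z rule: ideal_prod.induct)
      case (prod i j)
      then obtain c where c: "c \<in> carrier R" "i = c \<otimes> x" unfolding cgenideal_def by blast
      have "i \<otimes> j = (c \<otimes> j) \<otimes> x" using c prod x maxi.Icarr m_comm m_assoc by auto
      then show ?case using maxi.I_l_closed prod c by blast
    next
      case (sum s1 s2)
      then obtain a b where "a \<in> \<mm>" "s1 = a \<otimes> x" "b \<in> \<mm>" "s2 = b \<otimes> x" by blast
      then show ?case using x maxi.Icarr by (intro bexI[of _ "a \<oplus> b"]) (auto simp: l_distr)
    qed
    note Kform = this
    have "?K \<subseteq> J" using Kform xy(1) J.I_l_closed maxi.Icarr by blast
    moreover have "?K \<in> ?F"
    proof (rule ccontr)
      assume "?K \<notin> ?F"
      then have zero: "k \<otimes> v = \<zero>" if "k \<in> ?K" "v \<in> I" for k v using K that by blast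
      have "I \<cdot> \<mm> \<subseteq> {z \<in> carrier R. \<forall>s\<in>{x}. s \<otimes> z \<in> {\<zero>}}"
      proof (rule ideal_prod_subset[OF ideal_colon[OF zeroideal]])
        fix u v assume uv: "u \<in> I" "v \<in> \<mm>"
        have "x \<otimes> v \<in> ?K" using cgenideal_self[OF x] uv by (intro ideal_prod.prod)
        then have "x \<otimes> v \<otimes> u = \<zero>" using zero uv by blast
        moreover have "x \<otimes> v \<otimes> u = x \<otimes> (u \<otimes> v)" using x uv I.Icarr maxi.Icarr m_comm m_assoc by auto
        ultimately show "u \<otimes> v \<in> {z \<in> carrier R. \<forall>s\<in>{x}. s \<otimes> z \<in> {\<zero>}}"
          using uv I.Icarr maxi.Icarr by simp
      qed (use x in auto)
      then show False using xy Im by auto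
    qed
    ultimately have "x \<in> ?K" using min xy by blast
    then obtain a where "a \<in> \<mm>" "x = a \<otimes> x" using Kform by blast
    then have "x = \<zero>" by (rule eq_zero_if_eq_max_ideal_mult[OF x])
    then show False using xy I.Icarr[OF xy(2)] by simp
  qed
  then show ?thesis unfolding I_def by blast
qed

text \<open>Nakayama's lemma for a nilpotent maximal ideal, which may be used before finite generation is known:
substituting \<open>\<mm> = N + \<mm>\<^sup>2\<close> into itself gives \<open>\<mm> = N + \<mm>\<^sup>n\<close> for every \<open>n\<close>.\<close>

lemma max_ideal_eqI_mod_square:
  assumes "ideal N R" "N \<subseteq> \<mm>"
    and gen: "\<And>x. x \<in> \<mm> \<Longrightarrow> \<exists>u\<in>N. \<exists>v\<in>\<mm> \<cdot> \<mm>. x = u \<oplus> v"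
  shows "N = \<mm>"
proof -
  interpret N: ideal N R by fact
  have *: "\<exists>u\<in>N. \<exists>v\<in>\<mm>pow (Suc n). x = u \<oplus> v" if "x \<in> \<mm>" for x n
    using that
  proof (induct n arbitrary: x)
    case 0
    then show ?case using N.zero_closed maxi.Icarr by (intro bexI[of _ \<zero>] bexI[of _ x]) (auto simp: max_ideal_power_1)
  next
    case (Suc n)
    have id: "ideal (N <+>\<^bsub>R\<^esub> \<mm>pow (Suc (Suc n))) R" (is "ideal ?K R")
      by (intro add_ideals assms max_ideal_power_ideal)
    have memK: "a \<oplus> b \<in> ?K" if "a \<in> N" "b \<in> \<mm>pow (Suc (Suc n))" for a b
      using that unfolding set_add_def' by blast
    have NK: "a \<in> ?K" if "a \<in> N" for a
      using memK[OF that, of \<zero>] that N.Icarr additive_subgroup.zero_closed ideal.axioms(1) max_ideal_power_ideal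
      by fastforce
    have "\<mm> \<cdot> \<mm> \<subseteq> ?K"
    proof (rule ideal_prod_subset[OF id])
      fix x y assume xy: "x \<in> \<mm>" "y \<in> \<mm>"
      obtain u v where uv: "u \<in> N" "v \<in> \<mm>pow (Suc n)" "x = u \<oplus> v" using Suc.hyps[OF xy(1)] by blast
      have carr: "u \<in> carrier R" "v \<in> carrier R" "y \<in> carrier R"
        using uv xy N.Icarr maxi.Icarr ideal.Icarr[OF max_ideal_power_ideal] by auto
      have "v \<otimes> y \<in> \<mm>pow (Suc (Suc n))"
        using uv xy unfolding max_ideal_power_Suc[of "Suc n"] by (intro ideal_prod.prod)
      moreover have "u \<otimes> y \<in> N" using uv carr N.I_r_closed by simp
      ultimately show "x \<otimes> y \<in> ?K" using memK carr uv by (simp add: l_distr)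
    qed
    moreover obtain u v where uv: "u \<in> N" "v \<in> \<mm> \<cdot> \<mm>" "x = u \<oplus> v" using gen[OF Suc.prems] by blast
    ultimately have "u \<oplus> v \<in> ?K"
      using additive_subgroup.a_closed[OF ideal.axioms(1)[OF id] NK[OF uv(1)]] by blast
    then have "x \<in> ?K" using uv by simp
    then show ?case unfolding set_add_def' by blast
  qed
  obtain n where n: "\<mm>pow n = {\<zero>}" using max_ideal_nilpotent by blast
  have "\<mm>pow (Suc n) \<subseteq> {\<zero>}" using max_ideal_power_Suc_subset[of n] n by simp
  then have "x \<in> N" if "x \<in> \<mm>" for x using *[OF that, of n] N.Icarr by auto
  then show ?thesis using assms(2) by blast
qed

text \<open>Among the ideals \<open>J\<close> between \<open>\<mm>\<^sup>2\<close> and \<open>\<mm>\<close> such that finitely many elements generate \<open>\<mm>\<close> modulo \<open>J\<close>,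
take a minimal one.  If it contained an element \<open>x\<close> outside \<open>\<mm>\<^sup>2\<close>, then an ideal \<open>M \<supseteq> \<mm>\<^sup>2\<close> that is
maximal without \<open>x\<close> would meet \<open>J\<close> in a hyperplane with \<open>J = (M \<inter> J) + (x)\<close>, so \<open>M \<inter> J\<close> would be a
smaller ideal of the same kind.  Thus \<open>J = \<mm>\<^sup>2\<close>, and Nakayama's lemma applies.\<close>

lemma ex_finite_generators:
  "\<exists>A. A \<subseteq> carrier R \<and> finite A \<and> Idl A = \<mm>"
proof -
  define F where "F = {J. ideal J R \<and> \<mm> \<cdot> \<mm> \<subseteq> J \<and> J \<subseteq> \<mm>
    \<and> (\<exists>A. finite A \<and> A \<subseteq> \<mm> \<and> (\<forall>x\<in>\<mm>. \<exists>u\<in>J. \<exists>v\<in>Idl A. x = u \<oplus> v))}"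
  have FI: "J \<in> F" if "ideal J R" "\<mm> \<cdot> \<mm> \<subseteq> J" "J \<subseteq> \<mm>" "finite A" "A \<subseteq> \<mm>"
    "\<And>x. x \<in> \<mm> \<Longrightarrow> \<exists>u\<in>J. \<exists>v\<in>Idl A. x = u \<oplus> v" for J A
    unfolding F_def mem_Collect_eq using that by (intro conjI exI[of _ A] ballI) auto
  have FE: "ideal J R \<and> \<mm> \<cdot> \<mm> \<subseteq> J \<and> J \<subseteq> \<mm>" if "J \<in> F" for J
    using that unfolding F_def by simp
  have mm: "\<mm> \<cdot> \<mm> \<subseteq> \<mm>" using ideal_prod_inter[OF maxi.is_ideal maxi.is_ideal] by blast
  have "\<mm> \<in> F"
  proof (rule FI[of _ "{}"])
    have z: "\<zero> \<in> Idl {}" using genideal_ideal[of "{}"] additive_subgroup.zero_closed ideal.axioms(1) by blast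
    show "\<exists>u\<in>\<mm>. \<exists>v\<in>Idl {}. x = u \<oplus> v" if "x \<in> \<mm>" for x
      by (rule bexI[OF bexI[OF _ z] that]) (use that maxi.Icarr in simp)
  qed (use mm maxi.is_ideal in auto)
  then obtain J where J: "J \<in> F" and min: "\<And>K. K \<in> F \<Longrightarrow> K \<subseteq> J \<Longrightarrow> K = J"
    using artinian_ring_minimal_ideal[OF artinian, of F] FE by (metis empty_iff)
  obtain A where A: "finite A" "A \<subseteq> \<mm>" "\<And>x. x \<in> \<mm> \<Longrightarrow> \<exists>u\<in>J. \<exists>v\<in>Idl A. x = u \<oplus> v"
    using J unfolding F_def by auto
  have id: "ideal J R" "\<mm> \<cdot> \<mm> \<subseteq> J" "J \<subseteq> \<mm>" using FE[OF J] by auto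
  interpret J: ideal J R by fact
  have Am: "A \<subseteq> carrier R" using A(2) maxi.a_subset by blast
  have "J \<subseteq> \<mm> \<cdot> \<mm>"
  proof (rule ccontr)
    assume "\<not> J \<subseteq> \<mm> \<cdot> \<mm>"
    then obtain x where x: "x \<in> J" "x \<notin> \<mm> \<cdot> \<mm>" by blast
    have xc: "x \<in> carrier R" using x J.Icarr by simp
    obtain M where M: "ideal M R" "\<mm> \<cdot> \<mm> \<subseteq> M" "x \<notin> M" and max: "\<And>K. ideal K R \<Longrightarrow> M \<subset> K \<Longrightarrow> x \<in> K"
      using ex_ideal_maximal_avoiding[OF ideal_prod_is_ideal[OF maxi.is_ideal maxi.is_ideal] xc x(2)] by metis
    interpret M: ideal M R by fact
    \<comment> \<open>Maximality of \<open>M\<close> puts \<open>x\<close> into \<open>M + (z)\<close>, and the coefficient of \<open>z\<close> is a unit because \<open>\<mm> z \<subseteq> \<mm>\<^sup>2 \<subseteq> M\<close>.\<close>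
    have decomp: "\<exists>u\<in>M \<inter> J. \<exists>b\<in>carrier R. z = u \<oplus> b \<otimes> x" if z: "z \<in> J" for z
    proof (cases "z \<in> M")
      case True
      then show ?thesis using z xc J.Icarr by (intro bexI[of _ z] bexI[of _ \<zero>]) auto
    next
      case False
      have zc: "z \<in> carrier R" using z J.Icarr by simp
      have "M \<subset> M <+>\<^bsub>R\<^esub> PIdl z" using add_cgenideal_ideal[OF M(1) zc] False by blast
      then have "x \<in> M <+>\<^bsub>R\<^esub> PIdl z" using max add_cgenideal_ideal[OF M(1) zc] by blast
      then obtain k a where ka: "k \<in> M" "a \<in> carrier R" "x = k \<oplus> a \<otimes> z" by (rule add_cgenideal_memE)
      have kc: "k \<in> carrier R" using ka M.Icarr by simp
      have "a \<notin> \<mm>"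
      proof
        assume "a \<in> \<mm>"
        then have "a \<otimes> z \<in> M" using z id(3) M(2) ideal_prod.prod[of a \<mm> z \<mm>] by blast
        then show False using ka M(3) by simp
      qed
      then have u: "a \<in> Units R" using ka Units_iff by simp
      have "k = x \<ominus> a \<otimes> z" using ka(3) kc ka(2) zc by algebra
      then have kJ: "k \<in> J" using x z ka(2) J.I_l_closed J.a_closed J.a_inv_closed by (simp add: a_minus_def)
      have "z = (\<ominus> (inv a)) \<otimes> k \<oplus> inv a \<otimes> x" unfolding ka(3) by (rule unit_coeff_solve[OF u kc zc])
      moreover have "(\<ominus> (inv a)) \<otimes> k \<in> M \<inter> J" using kJ ka(1) u M.I_l_closed J.I_l_closed by simp
      ultimately show ?thesis using u by blast
    qed
    have idA: "ideal (Idl (insert x A)) R" using xc Am by (intro genideal_ideal) auto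
    have "M \<inter> J \<in> F"
    proof (rule FI[of _ "insert x A"])
      show "\<exists>u\<in>M \<inter> J. \<exists>v\<in>Idl (insert x A). y = u \<oplus> v" if y: "y \<in> \<mm>" for y
      proof -
        obtain z w where zw: "z \<in> J" "w \<in> Idl A" "y = z \<oplus> w" using A(3)[OF y] by blast
        obtain u b where ub: "u \<in> M \<inter> J" "b \<in> carrier R" "z = u \<oplus> b \<otimes> x" using decomp[OF zw(1)] by blast
        have w: "w \<in> Idl (insert x A)" using zw(2) subset_Idl_subset[of "insert x A" A] xc Am by blast
        have "x \<in> Idl (insert x A)" using genideal_self[of "insert x A"] xc Am by blast
        then have "b \<otimes> x \<oplus> w \<in> Idl (insert x A)"
          using w ub idA by (simp add: additive_subgroup.a_closed ideal.I_l_closed ideal.axioms(1))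
        moreover have "y = u \<oplus> (b \<otimes> x \<oplus> w)"
          using zw ub xc w ideal.Icarr[OF idA w] J.Icarr by (auto simp: a_assoc)
        ultimately show ?thesis using ub by blast
      qed
    qed (use A x id M(2) i_intersect[OF M(1) id(1)] in auto)
    then have "M \<inter> J = J" by (rule min) simp
    then show False using x M(3) by blast
  qed
  have "Idl A = \<mm>"
  proof (rule max_ideal_eqI_mod_square)
    show "ideal (Idl A) R" using Am by (rule genideal_ideal)
    show sub: "Idl A \<subseteq> \<mm>" using A(2) maxi.is_ideal by (intro genideal_minimal)
    fix x assume "x \<in> \<mm>"
    then obtain u v where uv: "u \<in> J" "v \<in> Idl A" "x = u \<oplus> v" using A(3) by blast
    then have "x = v \<oplus> u" using a_comm[of u v] J.Icarr sub maxi.Icarr by auto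
    then show "\<exists>u\<in>Idl A. \<exists>v\<in>\<mm> \<cdot> \<mm>. x = u \<oplus> v" using uv \<open>J \<subseteq> \<mm> \<cdot> \<mm>\<close> by blast
  qed
  then show ?thesis using A(1) Am by blast
qed

lemma edim_generators:
  obtains A where "A \<subseteq> carrier R" "finite A" "card A = edim R" "Idl A = \<mm>"
proof -
  have "\<exists>n A. A \<subseteq> carrier R \<and> finite A \<and> card A = n \<and> Idl A = \<mm>" using ex_finite_generators by blast
  from LeastI_ex[OF this] show thesis using that unfolding edim_def by blast
qed

text \<open>Steinitz exchange in \<open>\<mm> / \<mm>\<^sup>2\<close>, for a possibly infinite set \<open>Z\<close>.  Remove some \<open>a \<in> A - Z\<close> from \<open>A\<close>.  If
\<open>Z\<close> lies in the ideal generated by the rest and \<open>\<mm>\<^sup>2\<close>, then the rest generates \<open>\<mm>\<close>.  Otherwise some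
\<open>z \<in> Z\<close> lies outside that ideal, so \<open>a\<close> has a unit coefficient in \<open>z\<close>, and \<open>z\<close> can take the place of
\<open>a\<close>.  In both cases \<open>card (A - Z)\<close> decreases.\<close>

lemma exchange_generators:
  assumes "finite A" "A \<subseteq> carrier R" "Idl A = \<mm>" "Z \<subseteq> carrier R" "Idl Z = \<mm>"
  shows "\<exists>B\<subseteq>Z. finite B \<and> card B \<le> card A \<and> Idl B = \<mm>"
  using assms(1-3)
proof (induct "card (A - Z)" arbitrary: A rule: less_induct)
  case less
  show ?case
  proof (cases "A \<subseteq> Z")
    case True then show ?thesis using less.prems by blast
  next
    case False
    then obtain a where a: "a \<in> A" "a \<notin> Z" by blast
    let ?A = "A - {a}"
    have A': "finite ?A" "?A \<subseteq> carrier R" "?A - Z \<subset> A - Z" using less.prems a by auto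
    have cardA: "card A = Suc (card ?A)" using card.remove[OF less.prems(1) a(1)] .
    have Ac: "a \<in> carrier R" using a less.prems by blast
    let ?N = "Idl ?A <+>\<^bsub>R\<^esub> \<mm> \<cdot> \<mm>"
    have idN: "ideal ?N R" using A' by (intro add_ideals genideal_ideal ideal_prod_is_ideal maxi.is_ideal)
    interpret N: ideal ?N R by (rule idN)
    have Nmem: "u \<oplus> v \<in> ?N" if "u \<in> Idl ?A" "v \<in> \<mm> \<cdot> \<mm>" for u v using that unfolding set_add_def' by blast
    have Am: "Idl ?A \<subseteq> \<mm>" using subset_Idl_subset[of A ?A] less.prems by auto
    show ?thesis
    proof (cases "Z \<subseteq> ?N")
      case True
      then have "\<mm> \<subseteq> ?N" using genideal_minimal[OF idN True] assms(5) by simp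
      then have "\<exists>u\<in>Idl ?A. \<exists>v\<in>\<mm> \<cdot> \<mm>. x = u \<oplus> v" if "x \<in> \<mm>" for x using that unfolding set_add_def' by blast
      then have "Idl ?A = \<mm>" using Am A' by (intro max_ideal_eqI_mod_square genideal_ideal)
      moreover have "card (?A - Z) < card (A - Z)" using A' less.prems by (meson finite_Diff psubset_card_mono)
      ultimately obtain B where "B \<subseteq> Z" "finite B" "card B \<le> card ?A" "Idl B = \<mm>"
        using less.hyps[of ?A] A' by blast
      then show ?thesis using cardA by (metis le_SucI)
    next
      case False
      then obtain z where z: "z \<in> Z" "z \<notin> ?N" by blast
      have zc: "z \<in> carrier R" using z assms by blast
      have zm: "z \<in> \<mm>" using z assms genideal_self by blast
      have idA: "ideal (Idl ?A) R" using A' by (intro genideal_ideal)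
      have sub: "A \<subseteq> Idl ?A <+>\<^bsub>R\<^esub> PIdl a"
        using add_cgenideal_ideal[OF idA Ac] genideal_self[OF A'(2)] by blast
      then have "\<mm> \<subseteq> Idl ?A <+>\<^bsub>R\<^esub> PIdl a"
        using genideal_minimal[OF add_cgenideal_ideal(1)[OF idA Ac] sub] less.prems by simp
      then obtain k c where kc: "k \<in> Idl ?A" "c \<in> carrier R" "z = k \<oplus> c \<otimes> a"
        using zm add_cgenideal_memE by blast
      have kC: "k \<in> carrier R" using kc Am maxi.Icarr by blast
      have am: "a \<in> \<mm>" using a less.prems genideal_self by blast
      have "c \<notin> \<mm>"
      proof
        assume "c \<in> \<mm>"
        then have "c \<otimes> a \<in> \<mm> \<cdot> \<mm>" using am by (intro ideal_prod.prod)
        then show False using Nmem kc z by simp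
      qed
      then have u: "c \<in> Units R" using kc Units_iff by simp
      let ?B = "insert z ?A"
      have Bc: "?B \<subseteq> carrier R" using zc A' by blast
      have idB: "ideal (Idl ?B) R" using Bc by (rule genideal_ideal)
      interpret B: ideal "Idl ?B" R by (rule idB)
      have kB: "k \<in> Idl ?B" "z \<in> Idl ?B" using kc subset_Idl_subset[OF Bc, of ?A] genideal_self[OF Bc] by auto
      have "a = (\<ominus> (inv c)) \<otimes> k \<oplus> inv c \<otimes> z" unfolding kc(3) by (rule unit_coeff_solve[OF u kC Ac])
      then have "a \<in> Idl ?B" using kB u B.I_l_closed B.a_closed by (metis Units_inv_closed a_inv_closed)
      then have sub: "A \<subseteq> Idl ?B" using genideal_self[OF Bc] by blast
      then have "\<mm> \<subseteq> Idl ?B" using genideal_minimal[OF idB sub] less.prems by simp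
      moreover have "Idl ?B \<subseteq> \<mm>"
        using genideal_self[of A] less.prems zm by (intro genideal_minimal maxi.is_ideal) auto
      ultimately have "Idl ?B = \<mm>" by blast
      moreover have "?B - Z = ?A - Z" using z(1) by (rule insert_Diff1)
      moreover have "card (?A - Z) < card (A - Z)" using A'(3) less.prems(1) by (simp add: psubset_card_mono)
      moreover have "finite ?B" using A'(1) by simp
      ultimately have "\<exists>B\<subseteq>Z. finite B \<and> card B \<le> card ?B \<and> Idl B = \<mm>"
        by (intro less.hyps Bc) simp_all
      moreover have "card ?B \<le> card A" using cardA A'(1) by (simp add: card_insert_if)
      ultimately show ?thesis by (meson le_trans)
    qed
  qed
qed

end


section \<open>Monomials\<close>

text \<open>The products of \<open>i\<close> factors from a list, arranged for Pascal's rule: such a product contains the first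
factor or it is a product of factors from the tail.\<close>

fun monomials :: "('a, 'm) ring_scheme \<Rightarrow> 'a list \<Rightarrow> nat \<Rightarrow> 'a set" where
  "monomials R [] i = (if i = 0 then {\<one>\<^bsub>R\<^esub>} else {})"
| "monomials R (x # xs) 0 = {\<one>\<^bsub>R\<^esub>}"
| "monomials R (x # xs) (Suc i) = (\<lambda>u. x \<otimes>\<^bsub>R\<^esub> u) ` monomials R (x # xs) i \<union> monomials R xs (Suc i)"

lemma monomials_0: "monomials R xs 0 = {\<one>\<^bsub>R\<^esub>}"
  by (cases xs) auto

lemma finite_monomials: "finite (monomials R xs i)"
  by (induct R xs i rule: monomials.induct) auto

text \<open>Pascal's rule.  In the case of no variables and degree \<open>0\<close> the truncated difference \<open>0 + 0 - 1 = 0\<close>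
gives the correct count \<open>1\<close>.\<close>

lemma card_monomials_le: "card (monomials R xs i) \<le> (length xs + i - 1) choose i"
proof (induct R xs i rule: monomials.induct)
  case (3 R x xs i)
  have "card (monomials R (x # xs) (Suc i))
      \<le> card ((\<lambda>u. x \<otimes>\<^bsub>R\<^esub> u) ` monomials R (x # xs) i) + card (monomials R xs (Suc i))"
    by (simp add: card_Un_le)
  also have "\<dots> \<le> card (monomials R (x # xs) i) + card (monomials R xs (Suc i))"
    by (simp add: card_image_le finite_monomials)
  also have "\<dots> \<le> (length xs + i choose i) + (length xs + i choose Suc i)"
    using 3 by simp
  also have "\<dots> = (length (x # xs) + Suc i - 1) choose Suc i" by simp
  finally show ?case .
qed auto

context cring
begin

lemma monomials_closed: "set xs \<subseteq> carrier R \<Longrightarrow> monomials R xs i \<subseteq> carrier R"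
proof (induct xs arbitrary: i)
  case (Cons x xs)
  show ?case
    by (induct i) (use Cons in auto)
qed auto

lemma monomials_mult:
  assumes "set xs \<subseteq> carrier R" "y \<in> set xs" "u \<in> monomials R xs i"
  shows "y \<otimes> u \<in> monomials R xs (Suc i)"
  using assms
proof (induct xs arbitrary: i u)
  case (Cons x xs)
  have xc: "x \<in> carrier R" "y \<in> carrier R" using Cons.prems by auto
  show ?case
  proof (cases "y = x")
    case True
    then show ?thesis using Cons.prems(3) by simp
  next
    case False
    then have y: "y \<in> set xs" using Cons.prems by simp
    show ?thesis
      using Cons.prems(3)
    proof (induct i arbitrary: u)
      case 0
      then show ?case using Cons.hyps[of \<one> 0] Cons.prems(1) y by (auto simp: monomials_0)
    next
      case (Suc i)
      then consider u' where "u' \<in> monomials R (x # xs) i" "u = x \<otimes> u'" | "u \<in> monomials R xs (Suc i)"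
        by auto
      then show ?case
      proof cases
        case 1
        have "u' \<in> carrier R" using 1 monomials_closed[of "x # xs" i] Cons.prems(1) by blast
        then have "y \<otimes> u = x \<otimes> (y \<otimes> u')" using 1 xc m_lcomm by simp
        moreover have "y \<otimes> u' \<in> monomials R (x # xs) (Suc i)" by (rule Suc.hyps[OF 1(1)])
        ultimately show ?thesis by (metis UnI1 imageI monomials.simps(3))
      next
        case 2
        have "y \<otimes> u \<in> monomials R xs (Suc (Suc i))" using Cons.hyps[OF _ y 2] Cons.prems(1) by simp
        then show ?thesis by simp
      qed
    qed
  qed
qed auto

text \<open>The degree is positive, so \<open>u\<close> has a factor in \<open>ys\<close>.\<close>

lemma monomials_annihilated:
  assumes "set ys \<subseteq> carrier R" "x \<in> carrier R" "\<And>y. y \<in> set ys \<Longrightarrow> x \<otimes> y = \<zero>"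
    and "u \<in> monomials R ys (Suc i)"
  shows "x \<otimes> u = \<zero>"
  using assms
proof (induct ys)
  case (Cons y ys)
  from Cons.prems(4) consider u' where "u' \<in> monomials R (y # ys) i" "u = y \<otimes> u'" | "u \<in> monomials R ys (Suc i)"
    by auto
  then show ?case
  proof cases
    case 1
    have u': "u' \<in> carrier R" using 1 monomials_closed[of "y # ys" i] Cons.prems(1) by blast
    then have "x \<otimes> u = (x \<otimes> y) \<otimes> u'" using 1 Cons.prems(1,2) by (simp add: m_assoc)
    then show ?thesis using Cons.prems(3)[of y] u' by simp
  next
    case 2
    then show ?thesis using Cons by simp
  qed
qed auto

end

context local_cring
begin

lemma monomials_subset_power:
  assumes "set xs \<subseteq> \<mm>" shows "monomials R xs i \<subseteq> \<mm>pow i"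
  using assms
proof (induct xs arbitrary: i)
  case Nil
  then show ?case by (auto simp: max_ideal_power_0)
next
  case (Cons x xs)
  have x: "x \<in> \<mm>" "x \<in> carrier R" using Cons.prems maxi.Icarr by auto
  show ?case
  proof (induct i)
    case 0 then show ?case by (simp add: max_ideal_power_0)
  next
    case (Suc i)
    have "x \<otimes> u \<in> \<mm>pow (Suc i)" if u: "u \<in> monomials R (x # xs) i" for u
    proof -
      have um: "u \<in> \<mm>pow i" using u Suc by blast
      then have "u \<otimes> x \<in> \<mm>pow (Suc i)"
        unfolding max_ideal_power_Suc using x by (intro ideal_prod.prod)
      moreover have "x \<otimes> u = u \<otimes> x" using x um ideal.Icarr[OF max_ideal_power_ideal] by (intro m_comm) auto
      ultimately show ?thesis by simp
    qed
    moreover have "monomials R xs (Suc i) \<subseteq> \<mm>pow (Suc i)" using Cons by simp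
    ultimately show ?case by auto
  qed
qed

text \<open>The product of a monomial with a generator from its own family is a monomial of the next degree, and
the product with a generator from the other family is zero.  The latter fails for the monomial \<open>\<one>\<close>, so
the induction starts in degree one.\<close>

lemma max_ideal_power_eq_genideal_monomials:
  assumes "set xs \<subseteq> carrier R" "set ys \<subseteq> carrier R"
    and gen: "Idl (set xs \<union> set ys) = \<mm>"
    and xy: "\<And>x y. x \<in> set xs \<Longrightarrow> y \<in> set ys \<Longrightarrow> x \<otimes> y = \<zero>"
  shows "\<mm>pow (Suc i) = Idl (monomials R xs (Suc i) \<union> monomials R ys (Suc i))"
    (is "_ = Idl (?G i)")
proof
  have Gc: "?G i \<subseteq> carrier R" for i using monomials_closed assms(1,2) by blast
  have id: "ideal (Idl (?G i)) R" for i by (rule genideal_ideal[OF Gc])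
  have yx: "y \<otimes> x = \<zero>" if "x \<in> set xs" "y \<in> set ys" for x y
  proof -
    have "y \<otimes> x = x \<otimes> y" using that assms(1,2) by (intro m_comm) auto
    then show ?thesis using xy[OF that] by simp
  qed
  show "\<mm>pow (Suc i) \<subseteq> Idl (?G i)"
  proof (induct i)
    case 0
    have "x \<in> ?G 0" if "x \<in> set xs \<union> set ys" for x
    proof -
      have "x \<otimes> \<one> \<in> ?G 0"
        using that monomials_mult[OF assms(1), of x \<one> 0] monomials_mult[OF assms(2), of x \<one> 0]
        by (auto simp: monomials_0)
      moreover have "x \<otimes> \<one> = x" using that assms(1,2) by auto
      ultimately show ?thesis by simp
    qed
    then have "set xs \<union> set ys \<subseteq> Idl (?G 0)" using genideal_self[OF Gc] by blast
    then show ?case using genideal_minimal[OF id, of "set xs \<union> set ys"] gen by (simp add: max_ideal_power_1)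
  next
    case (Suc i)
    have prods: "u \<otimes> z \<in> Idl (?G (Suc i))" if u: "u \<in> ?G i" and z: "z \<in> set xs \<union> set ys" for u z
    proof -
      have zc: "z \<in> carrier R" and uc: "u \<in> carrier R" using u z assms(1,2) Gc by blast+
      have "z \<otimes> u \<in> ?G (Suc i) \<union> {\<zero>}"
        using u z
      proof (elim UnE)
        assume "u \<in> monomials R xs (Suc i)" "z \<in> set xs"
        then show ?thesis using monomials_mult[OF assms(1)] by blast
      next
        assume "u \<in> monomials R ys (Suc i)" "z \<in> set ys"
        then show ?thesis using monomials_mult[OF assms(2)] by blast
      next
        assume "u \<in> monomials R ys (Suc i)" "z \<in> set xs"
        then show ?thesis using monomials_annihilated[OF assms(2) zc xy] by blast
      next
        assume "u \<in> monomials R xs (Suc i)" "z \<in> set ys"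
        then show ?thesis using monomials_annihilated[OF assms(1) zc yx] by blast
      qed
      moreover have "\<zero> \<in> Idl (?G (Suc i))" using id by (simp add: additive_subgroup.zero_closed ideal.axioms(1))
      then have "?G (Suc i) \<union> {\<zero>} \<subseteq> Idl (?G (Suc i))"
        using genideal_self[OF Gc[of "Suc i"]] by (intro Un_least) simp_all
      ultimately have "z \<otimes> u \<in> Idl (?G (Suc i))" by (meson subsetD)
      then show ?thesis using m_comm[OF zc uc] by simp
    qed
    have "\<mm>pow (Suc i) \<cdot> \<mm> \<subseteq> Idl (?G (Suc i))"
    proof (rule ideal_prod_subset[OF id])
      fix u z assume "u \<in> \<mm>pow (Suc i)" "z \<in> \<mm>"
      then show "u \<otimes> z \<in> Idl (?G (Suc i))"
        using Suc gen assms(1,2)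
        by (intro genideal_mult_mem[OF id Gc _ prods, of "set xs \<union> set ys"]) auto
    qed
    then show ?case using max_ideal_power_Suc[of "Suc i"] by simp
  qed
  have "set xs \<union> set ys \<subseteq> \<mm>" using genideal_self[of "set xs \<union> set ys"] gen assms(1,2) by simp
  then show "Idl (?G i) \<subseteq> \<mm>pow (Suc i)"
    using monomials_subset_power by (intro genideal_minimal[OF max_ideal_power_ideal]) auto
qed

section \<open>Generators of powers and the Hilbert function\<close>

lemma residue_field_field: "field (residue_field R)"
  unfolding residue_field_def by (rule maxi.quotient_is_field[OF is_cring])

lemma residue_field_simps:
  "carrier (residue_field R) = (\<lambda>a. \<mm> +> a) ` carrier R"
  "\<one>\<^bsub>residue_field R\<^esub> = \<mm> +> \<one>"
  "a \<in> carrier R \<Longrightarrow> b \<in> carrier R \<Longrightarrow> (\<mm> +> a) \<oplus>\<^bsub>residue_field R\<^esub> (\<mm> +> b) = \<mm> +> (a \<oplus> b)"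
  "a \<in> carrier R \<Longrightarrow> b \<in> carrier R \<Longrightarrow> (\<mm> +> a) \<otimes>\<^bsub>residue_field R\<^esub> (\<mm> +> b) = \<mm> +> (a \<otimes> b)"
  by (auto simp: residue_field_def FactRing_simps maxi.a_rcos_sum maxi.rcoset_mult_add)

text \<open>If \<open>\<mm> I \<subseteq> J\<close>, then the quotient \<open>I / J\<close> is a vector space over the residue field, with operations that
can be computed on representatives.\<close>

context
  fixes I J
  assumes I: "ideal I R" and J: "ideal J R" and mI: "\<And>a x. a \<in> \<mm> \<Longrightarrow> x \<in> I \<Longrightarrow> a \<otimes> x \<in> J"
begin

interpretation I: ideal I R by (rule I)
interpretation J: ideal J R by (rule J)

abbreviation "V \<equiv> subquotient R I J"

lemma subquotient_simps:
  "carrier V = (\<lambda>x. J +> x) ` I" "\<zero>\<^bsub>V\<^esub> = J" "A \<oplus>\<^bsub>V\<^esub> B = A <+>\<^bsub>R\<^esub> B"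
  by (simp_all add: subquotient_def)

lemma subquotient_add: "x \<in> I \<Longrightarrow> y \<in> I \<Longrightarrow> (J +> x) \<oplus>\<^bsub>V\<^esub> (J +> y) = J +> (x \<oplus> y)"
  unfolding subquotient_simps by (rule J.a_rcos_sum[OF I.Icarr I.Icarr])

lemma subquotient_zero: "\<zero>\<^bsub>V\<^esub> = J +> \<zero>"
  using a_rcos_zero[OF J] J.zero_closed by (simp add: subquotient_simps)

lemma subquotient_smult:
  assumes a: "a \<in> carrier R" and x: "x \<in> I"
  shows "(\<mm> +> a) \<odot>\<^bsub>V\<^esub> (J +> x) = J +> (a \<otimes> x)"
proof -
  have xc: "x \<in> carrier R" using x I.Icarr by simp
  \<comment> \<open>With \<open>b = c + a\<close> and \<open>y = j + x\<close>, the difference \<open>b y - a x = b j + c x\<close> lies in \<open>J + \<mm> I\<close>.\<close>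
  have eq: "J +> (b \<otimes> y) = J +> (a \<otimes> x)" if "b \<in> \<mm> +> a" "y \<in> J +> x" for b y
  proof -
    obtain c where c: "c \<in> \<mm>" "b = c \<oplus> a" using \<open>b \<in> \<mm> +> a\<close> unfolding a_r_coset_def' by blast
    obtain j where j: "j \<in> J" "y = j \<oplus> x" using \<open>y \<in> J +> x\<close> unfolding a_r_coset_def' by blast
    have cc: "c \<in> carrier R" "j \<in> carrier R" using c j maxi.Icarr J.Icarr by auto
    have "b \<otimes> y = (b \<otimes> j \<oplus> c \<otimes> x) \<oplus> a \<otimes> x"
      using c j cc a xc by (simp add: l_distr r_distr a_assoc)
    moreover have "b \<otimes> j \<oplus> c \<otimes> x \<in> J"
      using mI[OF c(1) x] J.I_l_closed[OF j(1)] c cc a by simp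
    ultimately have "b \<otimes> y \<in> J +> (a \<otimes> x)" unfolding a_r_coset_def' by blast
    then show ?thesis using a_repr_independence[of "b \<otimes> y" J "a \<otimes> x"] J.a_subgroup a xc by simp
  qed
  have "a \<in> \<mm> +> a" "x \<in> J +> x" using maxi.a_rcos_self[OF a] J.a_rcos_self[OF xc] by auto
  then have "(\<Union>b\<in>\<mm> +> a. \<Union>y\<in>J +> x. J +> (b \<otimes> y)) = J +> (a \<otimes> x)" using eq by blast
  then show ?thesis by (simp add: subquotient_def rcoset_mult_def)
qed

lemma vectorspace_subquotient: "vectorspace (residue_field R) V"
proof (intro vectorspace.intro moduleI residue_field_field)
  show "cring (residue_field R)" unfolding residue_field_def by (rule maxi.quotient_is_cring[OF is_cring])
  note carrI [simp] = I.Icarr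
  show "abelian_group V"
  proof (rule abelian_groupI)
    fix x y z assume "x \<in> carrier V" "y \<in> carrier V" "z \<in> carrier V"
    then show "x \<oplus>\<^bsub>V\<^esub> y \<oplus>\<^bsub>V\<^esub> z = x \<oplus>\<^bsub>V\<^esub> (y \<oplus>\<^bsub>V\<^esub> z)"
      unfolding subquotient_simps(1) by (auto simp: subquotient_add a_assoc simp del: subquotient_simps)
  next
    fix x y assume "x \<in> carrier V" "y \<in> carrier V"
    then show "x \<oplus>\<^bsub>V\<^esub> y = y \<oplus>\<^bsub>V\<^esub> x" "x \<oplus>\<^bsub>V\<^esub> y \<in> carrier V"
      unfolding subquotient_simps(1) by (auto simp: subquotient_add a_comm)
  next
    fix x assume "x \<in> carrier V"
    then obtain u where u: "u \<in> I" "x = J +> u" unfolding subquotient_simps(1) by auto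
    show "\<zero>\<^bsub>V\<^esub> \<oplus>\<^bsub>V\<^esub> x = x" using u by (simp add: subquotient_zero subquotient_add)
    have "(J +> \<ominus> u) \<oplus>\<^bsub>V\<^esub> x = \<zero>\<^bsub>V\<^esub>" using u by (simp add: subquotient_zero subquotient_add l_neg)
    then show "\<exists>y\<in>carrier V. y \<oplus>\<^bsub>V\<^esub> x = \<zero>\<^bsub>V\<^esub>" using u unfolding subquotient_simps(1) by blast
  next
    show "\<zero>\<^bsub>V\<^esub> \<in> carrier V" unfolding subquotient_zero unfolding subquotient_simps(1) by simp
  qed
next
  fix a x assume "a \<in> carrier (residue_field R)" "x \<in> carrier V"
  then obtain a' x' where "a' \<in> carrier R" "a = \<mm> +> a'" "x' \<in> I" "x = J +> x'"
    unfolding residue_field_simps(1) subquotient_simps(1) by blast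
  then have "a \<odot>\<^bsub>V\<^esub> x = J +> (a' \<otimes> x')" "a' \<otimes> x' \<in> I" by (simp_all add: subquotient_smult I.I_l_closed)
  then show "a \<odot>\<^bsub>V\<^esub> x \<in> carrier V" unfolding subquotient_simps(1) by blast
next
  fix x assume "x \<in> carrier V"
  then obtain x' where "x' \<in> I" "x = J +> x'" unfolding subquotient_simps(1) by blast
  then show "\<one>\<^bsub>residue_field R\<^esub> \<odot>\<^bsub>V\<^esub> x = x" by (simp add: residue_field_simps subquotient_smult)
next
  fix a b x assume "a \<in> carrier (residue_field R)" "b \<in> carrier (residue_field R)" "x \<in> carrier V"
  then obtain a' b' x' where "a' \<in> carrier R" "a = \<mm> +> a'" "b' \<in> carrier R" "b = \<mm> +> b'" "x' \<in> I" "x = J +> x'"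
    unfolding residue_field_simps(1) subquotient_simps(1) by blast
  moreover from this have "x' \<in> carrier R" by simp
  ultimately show "(a \<oplus>\<^bsub>residue_field R\<^esub> b) \<odot>\<^bsub>V\<^esub> x = a \<odot>\<^bsub>V\<^esub> x \<oplus>\<^bsub>V\<^esub> b \<odot>\<^bsub>V\<^esub> x"
    "(a \<otimes>\<^bsub>residue_field R\<^esub> b) \<odot>\<^bsub>V\<^esub> x = a \<odot>\<^bsub>V\<^esub> (b \<odot>\<^bsub>V\<^esub> x)"
    by (simp_all add: residue_field_simps subquotient_smult subquotient_add I.I_l_closed l_distr m_assoc)
next
  fix a x y assume "a \<in> carrier (residue_field R)" "x \<in> carrier V" "y \<in> carrier V"
  then obtain a' x' y' where "a' \<in> carrier R" "a = \<mm> +> a'" "x' \<in> I" "x = J +> x'" "y' \<in> I" "y = J +> y'"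
    unfolding residue_field_simps(1) subquotient_simps(1) by blast
  moreover from this have "x' \<in> carrier R" "y' \<in> carrier R" by simp_all
  ultimately show "a \<odot>\<^bsub>V\<^esub> (x \<oplus>\<^bsub>V\<^esub> y) = a \<odot>\<^bsub>V\<^esub> x \<oplus>\<^bsub>V\<^esub> a \<odot>\<^bsub>V\<^esub> y"
    by (simp add: subquotient_smult subquotient_add I.I_l_closed r_distr)
qed

text \<open>The elements of \<open>I\<close> whose classes lie in the span of the classes of \<open>S\<close> form an ideal, and this ideal
contains \<open>S\<close>.\<close>

lemma dim_subquotient_le:
  assumes S: "finite S" "S \<subseteq> carrier R" "Idl S = I"
  shows "vectorspace.dim (residue_field R) V \<le> card S"
proof -
  interpret V: vectorspace "residue_field R" V by (rule vectorspace_subquotient)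
  let ?B = "(\<lambda>x. J +> x) ` S"
  have SI: "S \<subseteq> I" using genideal_self[OF S(2)] S(3) by simp
  then have B: "?B \<subseteq> carrier V" unfolding subquotient_simps(1) by blast
  note sub = V.span_is_submodule[OF B]
  have "ideal {x \<in> I. J +> x \<in> V.span ?B} R"
  proof (rule cring_idealI)
    show "{x \<in> I. J +> x \<in> V.span ?B} \<subseteq> carrier R" using I.Icarr by blast
    show "\<zero> \<in> {x \<in> I. J +> x \<in> V.span ?B}"
      using LinearCombinations.submodule.zero_closed[OF sub] by (simp add: subquotient_zero)
  next
    fix x y assume x: "x \<in> {x \<in> I. J +> x \<in> V.span ?B}"
    show "x \<oplus> y \<in> {x \<in> I. J +> x \<in> V.span ?B}" if y: "y \<in> {x \<in> I. J +> x \<in> V.span ?B}"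
      using LinearCombinations.submodule.m_closed[OF sub, of "J +> x" "J +> y"] x y subquotient_add[of x y] by simp
    fix a assume a: "a \<in> carrier R"
    show "a \<otimes> x \<in> {x \<in> I. J +> x \<in> V.span ?B}"
      using LinearCombinations.submodule.smult_closed[OF sub, of "\<mm> +> a" "J +> x"] x a subquotient_smult[OF a, of x]
      by (simp add: I.I_l_closed residue_field_simps(1))
  qed
  moreover have "S \<subseteq> {x \<in> I. J +> x \<in> V.span ?B}" using SI V.in_own_span[OF B] by blast
  ultimately have "I \<subseteq> {x \<in> I. J +> x \<in> V.span ?B}" using genideal_minimal[of _ S] S(3) by blast
  then have "carrier V \<subseteq> V.span ?B" unfolding subquotient_simps(1) by blast
  moreover have "V.span ?B \<subseteq> carrier V" by (rule LinearCombinations.submodule.subset[OF sub])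
  ultimately have "V.dim \<le> card ?B" using S(1) B by (intro V.gen_ge_dim) auto
  also have "\<dots> \<le> card S" using S(1) by (rule card_image_le)
  finally show ?thesis .
qed

end

lemma hilbert_function_le_card_generators:
  assumes "finite S" "S \<subseteq> carrier R" "Idl S = \<mm>pow i"
  shows "hilbert_function R i \<le> card S"
  unfolding hilbert_function_def
proof (rule dim_subquotient_le[OF max_ideal_power_ideal max_ideal_power_ideal _ assms])
  fix a x assume "a \<in> \<mm>" "x \<in> \<mm>pow i"
  moreover have "a \<otimes> x = x \<otimes> a"
    using calculation maxi.Icarr ideal.Icarr[OF max_ideal_power_ideal] by (intro m_comm) auto
  ultimately show "a \<otimes> x \<in> \<mm>pow (Suc i)" unfolding max_ideal_power_Suc by (simp add: ideal_prod.prod)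
qed

end

section \<open>Orthogonal generators\<close>

text \<open>Convexity in the number of variables: for a fixed total number of variables and a fixed degree, two
separate sets of variables have the most monomials when one of the sets has a single element.\<close>

lemma binomial_superadditive:
  assumes "a \<ge> 1"
  shows "(a + i - 1 choose i) + (Suc b + i - 1 choose i) \<le> (a + b + i - 1 choose i) + 1"
proof (induct b)
  case (Suc b)
  show ?case
  proof (cases i)
    case (Suc j)
    have *: "(Suc n choose i) = (n choose i) + (n choose j)" for n unfolding Suc by simp
    define n where "n = a + b + i - 1"
    have eq: "Suc (Suc b) + i - 1 = Suc (b + i)" "a + Suc b + i - 1 = Suc n" "Suc b + i - 1 = b + i"
      using assms by (auto simp: n_def)
    have "(b + i choose j) \<le> (n choose j)"
      using assms unfolding n_def by (intro binomial_right_mono) auto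
    moreover have "(a + i - 1 choose i) + (b + i choose i) \<le> (n choose i) + 1"
      using Suc.hyps unfolding eq n_def .
    ultimately show ?thesis unfolding eq * by linarith
  qed auto
qed auto

text \<open>Exchange chooses at most \<open>edim R\<close> generators of \<open>\<mm>\<close> from \<open>I \<union> L\<close>.  They do not all lie in \<open>L\<close>:
otherwise each \<open>x \<in> I\<close> would annihilate generators of \<open>\<mm>\<close>, hence all of \<open>\<mm>\<close> and in particular \<open>I\<close>.
By symmetry they do not all lie in \<open>I\<close>.\<close>

lemma (in artinian_local_cring) hilbert_function_le_if_orthogonal_generators:
  assumes IL: "I \<subseteq> carrier R" "L \<subseteq> carrier R" "Idl (I \<union> L) = \<mm>"
    and orth: "\<And>x y. x \<in> I \<Longrightarrow> y \<in> L \<Longrightarrow> x \<otimes> y = \<zero>"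
    and II: "\<exists>x\<in>I. \<exists>x'\<in>I. x \<otimes> x' \<noteq> \<zero>" and LL: "\<exists>y\<in>L. \<exists>y'\<in>L. y \<otimes> y' \<noteq> \<zero>"
    and "i \<ge> 1"
  shows "hilbert_function R i \<le> (edim R + i - 2 choose i) + 1"
proof -
  obtain A where A: "finite A" "A \<subseteq> carrier R" "Idl A = \<mm>" "card A = edim R"
    using edim_generators by metis
  obtain B where B: "B \<subseteq> I \<union> L" "finite B" "card B \<le> edim R" "Idl B = \<mm>"
    using exchange_generators[OF A(1-3) _ IL(3)] IL(1,2) A(4) by auto
  have genI: "I \<subseteq> \<mm>" "L \<subseteq> \<mm>" using genideal_self[of "I \<union> L"] IL by auto
  have not_all: "\<not> B \<subseteq> K'"
    if K: "K \<subseteq> \<mm>" "\<exists>x\<in>K. \<exists>x'\<in>K. x \<otimes> x' \<noteq> \<zero>" and KK': "\<And>x y. x \<in> K \<Longrightarrow> y \<in> K' \<Longrightarrow> x \<otimes> y = \<zero>" for K K'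
  proof
    assume BK: "B \<subseteq> K'"
    obtain x x' where x: "x \<in> K" "x' \<in> K" "x \<otimes> x' \<noteq> \<zero>" using K(2) by blast
    have xc: "x \<in> carrier R" using x K(1) maxi.Icarr by blast
    have "B \<subseteq> {z \<in> carrier R. \<forall>s\<in>{x}. s \<otimes> z \<in> {\<zero>}}"
      using BK B(1) IL(1,2) KK'[OF x(1)] by blast
    then have "Idl B \<subseteq> {z \<in> carrier R. \<forall>s\<in>{x}. s \<otimes> z \<in> {\<zero>}}"
      using xc by (intro genideal_minimal[OF ideal_colon[OF zeroideal]]) auto
    then show False using x K(1) B(4) by auto
  qed
  have orth': "y \<otimes> x = \<zero>" if "x \<in> I" "y \<in> L" for x y
  proof -
    have "y \<otimes> x = x \<otimes> y" using that IL(1,2) by (intro m_comm) auto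
    then show ?thesis using orth[OF that] by simp
  qed
  obtain xs where xs: "set xs = B \<inter> I" "distinct xs" using finite_distinct_list[of "B \<inter> I"] B(2) by auto
  obtain ys where ys: "set ys = B - I" "distinct ys" using finite_distinct_list[of "B - I"] B(2) by auto
  have len: "length xs = card (B \<inter> I)" "length ys = card (B - I)"
    using distinct_card[OF xs(2)] distinct_card[OF ys(2)] xs(1) ys(1) by simp_all
  have "length xs + length ys = card B"
    using card_Un_disjoint[of "B \<inter> I" "B - I"] B(2) len by (simp add: Int_Diff_Un Int_Diff_disjoint)
  then have sum: "length xs + length ys \<le> edim R" using B(3) by simp
  have "B \<inter> I \<noteq> {}" using not_all[OF genI(1) II orth] B(1) by blast
  then have a: "length xs \<ge> 1" using xs(1) by (cases xs) auto
  have "B - I \<noteq> {}" using not_all[OF genI(2) LL orth'] by blast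
  then have b: "length ys \<ge> 1" using ys(1) by (cases ys) auto
  have carr: "set xs \<subseteq> carrier R" "set ys \<subseteq> carrier R" using xs(1) ys(1) IL(1,2) B(1) by auto
  have "set xs \<union> set ys = B" using xs(1) ys(1) by blast
  then have gen: "Idl (set xs \<union> set ys) = \<mm>" using B(4) by simp
  have xy: "x \<otimes> y = \<zero>" if "x \<in> set xs" "y \<in> set ys" for x y using that xs(1) ys(1) B(1) orth by blast
  let ?G = "monomials R xs i \<union> monomials R ys i"
  obtain j where j: "i = Suc j" using \<open>i \<ge> 1\<close> by (cases i) auto
  have "\<mm>pow i = Idl ?G" using max_ideal_power_eq_genideal_monomials[OF carr gen xy, of j] j by simp
  then have "hilbert_function R i \<le> card ?G"
    using finite_monomials monomials_closed carr by (intro hilbert_function_le_card_generators) auto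
  also have "\<dots> \<le> (length xs + i - 1 choose i) + (length ys + i - 1 choose i)"
    by (rule order_trans[OF card_Un_le add_mono[OF card_monomials_le card_monomials_le]])
  also have "\<dots> \<le> (length xs + (length ys - 1) + i - 1 choose i) + 1"
    using binomial_superadditive[OF a, of i "length ys - 1"] b by simp
  also have "\<dots> \<le> (edim R + i - 2 choose i) + 1"
    using a b sum by (intro add_right_mono binomial_right_mono) linarith
  finally show ?thesis .
qed

section \<open>The two components of a connected sum\<close>

text \<open>One of the two rings of a connected sum over \<open>k\<close>.  The Gorenstein property enters through the chosen
generator \<open>\<delta>\<close> of the socle.\<close>

locale component = artinian_local_cring R + k: field k
  for R (structure) and k :: "('k, 'n) ring_scheme" +
  fixes \<pi> :: "'a \<Rightarrow> 'k" and \<delta> :: 'a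
  assumes residue: "residue_projection R k \<pi>"
    and not_field: "\<not> R \<simeq> k"
    and \<delta>_closed: "\<delta> \<in> carrier R"
    and socle_eq: "socle R = PIdl \<delta>"
begin

lemma \<pi>_hom: "\<pi> \<in> ring_hom R k" and \<pi>_surj: "\<pi> ` carrier R = carrier k"
  using residue unfolding residue_projection_def by auto

sublocale \<pi>: ring_hom_ring R k \<pi>
  using \<pi>_hom by (intro ring_hom_ringI2 ring_axioms k.ring_axioms)

text \<open>A surjection onto a field maps units to units, and an element with a nonzero image is a unit modulo
the kernel, which consists of nonunits.\<close>

lemma \<pi>_zero_iff: "x \<in> carrier R \<Longrightarrow> \<pi> x = \<zero>\<^bsub>k\<^esub> \<longleftrightarrow> x \<in> \<mm>"
proof -
  have kernel: "x \<in> \<mm>" if x: "x \<in> carrier R" "\<pi> x = \<zero>\<^bsub>k\<^esub>" for x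
  proof (rule ccontr)
    assume "x \<notin> \<mm>"
    then have u: "x \<in> Units R" using x Units_iff by simp
    have "\<pi> (inv x \<otimes> x) = \<zero>\<^bsub>k\<^esub>" using u x \<pi>.hom_mult[of "inv x" x] by simp
    then show False using u \<pi>.hom_one k.one_not_zero by simp
  qed
  assume x: "x \<in> carrier R"
  have "\<pi> x = \<zero>\<^bsub>k\<^esub>" if xm: "x \<in> \<mm>"
  proof (rule ccontr)
    assume "\<pi> x \<noteq> \<zero>\<^bsub>k\<^esub>"
    then have "\<pi> x \<in> Units k" using x k.field_Units by simp
    then obtain c where "c \<in> carrier k" "\<pi> x \<otimes>\<^bsub>k\<^esub> c = \<one>\<^bsub>k\<^esub>" by (meson k.Units_inv_closed k.Units_r_inv)
    moreover obtain y where "y \<in> carrier R" "c = \<pi> y" using \<pi>_surj calculation(1) by blast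
    ultimately have y: "y \<in> carrier R" "\<pi> x \<otimes>\<^bsub>k\<^esub> \<pi> y = \<one>\<^bsub>k\<^esub>" by auto
    then have "\<pi> (x \<otimes> y \<ominus> \<one>) = \<zero>\<^bsub>k\<^esub>" using x by (simp add: a_minus_def k.r_neg)
    then have "x \<otimes> y \<ominus> \<one> \<in> \<mm>" using kernel x y by simp
    moreover have "x \<otimes> y \<in> \<mm>" using xm y maxi.I_r_closed by simp
    ultimately have "x \<otimes> y \<ominus> (x \<otimes> y \<ominus> \<one>) \<in> \<mm>" by (simp add: a_minus_def)
    moreover have "x \<otimes> y \<ominus> (x \<otimes> y \<ominus> \<one>) = \<one>" using x y by algebra
    ultimately show False using one_notin_max_ideal by simp
  qed
  then show ?thesis using kernel x by blast
qed

lemma \<pi>_eq_iff: "x \<in> carrier R \<Longrightarrow> y \<in> carrier R \<Longrightarrow> \<pi> x = \<pi> y \<longleftrightarrow> x \<ominus> y \<in> \<mm>"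
  using \<pi>_zero_iff[of "x \<ominus> y"] k.r_right_minus_eq[of "\<pi> x" "\<pi> y"]
  by (simp add: a_minus_def)

text \<open>Otherwise the projection onto \<open>k\<close> is injective.\<close>

lemma max_ideal_nonzero: "\<mm> \<noteq> {\<zero>}"
proof
  assume m: "\<mm> = {\<zero>}"
  have "inj_on \<pi> (carrier R)"
  proof (rule inj_onI)
    fix x y assume xy: "x \<in> carrier R" "y \<in> carrier R" "\<pi> x = \<pi> y"
    then have "x \<ominus> y = \<zero>" using \<pi>_eq_iff m by simp
    then show "x = y" using xy by (simp add: r_right_minus_eq)
  qed
  then have "\<pi> \<in> ring_iso R k" using \<pi>_hom \<pi>_surj by (simp add: ring_iso_def bij_betw_def)
  then show False using not_field unfolding is_ring_iso_def by blast
qed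

lemma max_ideal_mult_\<delta>: "a \<in> \<mm> \<Longrightarrow> a \<otimes> \<delta> = \<zero>"
  using cgenideal_self[OF \<delta>_closed] socle_eq unfolding socle_def by blast

lemma unit_mult_eq_zero: "a \<in> carrier R \<Longrightarrow> a \<notin> \<mm> \<Longrightarrow> x \<in> carrier R \<Longrightarrow> a \<otimes> x = \<zero> \<Longrightarrow> x = \<zero>"
  by (metis Units_iff Units_inv_closed Units_l_inv l_one m_assoc r_null)

text \<open>A unit in the socle would annihilate \<open>\<mm>\<close>, so \<open>\<mm>\<close> would be zero.\<close>

lemma \<delta>_in_max_ideal: "\<delta> \<in> \<mm>"
proof (rule ccontr)
  assume d: "\<delta> \<notin> \<mm>"
  have "a = \<zero>" if "a \<in> \<mm>" for a
  proof (rule unit_mult_eq_zero[OF \<delta>_closed d])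
    show a: "a \<in> carrier R" using that maxi.Icarr by simp
    show "\<delta> \<otimes> a = \<zero>" using max_ideal_mult_\<delta>[OF that] m_comm[OF \<delta>_closed a] by simp
  qed
  then show False using max_ideal_nonzero maxi.zero_closed by blast
qed

text \<open>The last nonzero power of \<open>\<mm>\<close> is contained in the socle.\<close>

lemma \<delta>_nonzero: "\<delta> \<noteq> \<zero>"
proof
  assume d: "\<delta> = \<zero>"
  define n where "n = (LEAST n. \<mm>pow n = {\<zero>})"
  have n: "\<mm>pow n = {\<zero>}" unfolding n_def using max_ideal_nilpotent by (rule LeastI_ex)
  have "n \<noteq> 0"
  proof
    assume "n = 0"
    then have "\<one> = \<zero>" using n max_ideal_power_0 by auto
    then show False using one_notin_max_ideal maxi.zero_closed by simp
  qed
  then obtain j where j: "n = Suc j" by (cases n) auto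
  have "\<mm>pow j \<noteq> {\<zero>}" using not_less_Least[of j "\<lambda>n. \<mm>pow n = {\<zero>}"] j n_def by simp
  then obtain z where z: "z \<in> \<mm>pow j" "z \<noteq> \<zero>"
    using additive_subgroup.zero_closed[OF ideal.axioms(1)[OF max_ideal_power_ideal[of j]]] by blast
  have zc: "z \<in> carrier R" using z ideal.Icarr[OF max_ideal_power_ideal] by blast
  have "y \<otimes> z = \<zero>" if y: "y \<in> \<mm>" for y
  proof -
    have "z \<otimes> y \<in> \<mm>pow n" unfolding j max_ideal_power_Suc using z(1) y by (rule ideal_prod.prod)
    then show ?thesis using n m_comm[of y z] zc y maxi.Icarr by simp
  qed
  then have "z \<in> PIdl \<delta>" using zc socle_eq unfolding socle_def by blast
  then show False using z(2) d unfolding cgenideal_def by auto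
qed

lemma mult_\<delta>_eq_zero_iff: "a \<in> carrier R \<Longrightarrow> a \<otimes> \<delta> = \<zero> \<longleftrightarrow> a \<in> \<mm>"
  using max_ideal_mult_\<delta> unit_mult_eq_zero[OF _ _ \<delta>_closed] \<delta>_nonzero by blast

lemma max_ideal_power_2:
  assumes "\<And>a b. a \<in> \<mm> \<Longrightarrow> b \<in> \<mm> \<Longrightarrow> a \<otimes> b = \<zero>"
  shows "\<mm>pow 2 = {\<zero>}"
proof -
  have "\<mm>pow 2 = \<mm> \<cdot> \<mm>" using max_ideal_power_Suc[of "Suc 0"] max_ideal_power_1 by (simp add: numeral_2_eq_2)
  moreover have "\<mm> \<cdot> \<mm> \<subseteq> {\<zero>}" using assms by (intro ideal_prod_subset zeroideal) simp
  moreover have "\<zero> \<in> \<mm>pow 2"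
    using additive_subgroup.zero_closed[OF ideal.axioms(1)[OF max_ideal_power_ideal]] .
  ultimately show ?thesis by (intro subset_antisym) simp_all
qed

lemma max_ideal_subset_socle:
  assumes "\<And>a b. a \<in> \<mm> \<Longrightarrow> b \<in> \<mm> \<Longrightarrow> a \<otimes> b = \<zero>" "x \<in> \<mm>"
  obtains a where "a \<in> carrier R" "x = a \<otimes> \<delta>"
proof -
  have "x \<in> socle R" unfolding socle_def using assms(1)[OF _ assms(2)] maxi.Icarr[OF assms(2)] by simp
  then have "x \<in> PIdl \<delta>" using socle_eq by simp
  then show thesis using that unfolding cgenideal_def by blast
qed

end

section \<open>Connected sums\<close>

text \<open>A connected sum \<open>Q\<close>, seen through the composite \<open>g\<close> of the projection of the fibre product onto its
quotient with an isomorphism from that quotient to \<open>Q\<close>.  Only the values of \<open>g\<close> at pairs with equal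
residues matter.  The multiple of \<open>(\<delta>\<^sub>R, 0) - (0, \<delta>\<^sub>S)\<close> by such a pair \<open>(a, b)\<close> is
\<open>(a \<delta>\<^sub>R, - b \<delta>\<^sub>S)\<close>, which explains the description of the kernel.  In this form the roles of \<open>R\<close> and
\<open>S\<close> can be exchanged.\<close>

locale connected_sum_presentation =
  Q: local_cring Q + R: component R k \<pi>\<^sub>R \<delta>\<^sub>R + S: component S k \<pi>\<^sub>S \<delta>\<^sub>S
  for Q :: "('q, 'l) ring_scheme" and R :: "('a, 'm) ring_scheme" and S :: "('b, 'o) ring_scheme"
    and k :: "('k, 'n) ring_scheme" and \<pi>\<^sub>R \<delta>\<^sub>R \<pi>\<^sub>S \<delta>\<^sub>S +
  fixes g :: "'a \<Rightarrow> 'b \<Rightarrow> 'q"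
  assumes g_closed: "\<lbrakk>r \<in> carrier R; s \<in> carrier S; \<pi>\<^sub>R r = \<pi>\<^sub>S s\<rbrakk> \<Longrightarrow> g r s \<in> carrier Q"
    and g_add: "\<lbrakk>r \<in> carrier R; s \<in> carrier S; \<pi>\<^sub>R r = \<pi>\<^sub>S s; r' \<in> carrier R; s' \<in> carrier S; \<pi>\<^sub>R r' = \<pi>\<^sub>S s'\<rbrakk>
      \<Longrightarrow> g (r \<oplus>\<^bsub>R\<^esub> r') (s \<oplus>\<^bsub>S\<^esub> s') = g r s \<oplus>\<^bsub>Q\<^esub> g r' s'"
    and g_mult: "\<lbrakk>r \<in> carrier R; s \<in> carrier S; \<pi>\<^sub>R r = \<pi>\<^sub>S s; r' \<in> carrier R; s' \<in> carrier S; \<pi>\<^sub>R r' = \<pi>\<^sub>S s'\<rbrakk>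
      \<Longrightarrow> g (r \<otimes>\<^bsub>R\<^esub> r') (s \<otimes>\<^bsub>S\<^esub> s') = g r s \<otimes>\<^bsub>Q\<^esub> g r' s'"
    and g_one: "g \<one>\<^bsub>R\<^esub> \<one>\<^bsub>S\<^esub> = \<one>\<^bsub>Q\<^esub>"
    and g_surj: "q \<in> carrier Q \<Longrightarrow> \<exists>r\<in>carrier R. \<exists>s\<in>carrier S. \<pi>\<^sub>R r = \<pi>\<^sub>S s \<and> q = g r s"
    and g_zero_iff: "\<lbrakk>r \<in> carrier R; s \<in> carrier S; \<pi>\<^sub>R r = \<pi>\<^sub>S s\<rbrakk> \<Longrightarrow> g r s = \<zero>\<^bsub>Q\<^esub> \<longleftrightarrow>
      (\<exists>a\<in>carrier R. \<exists>b\<in>carrier S. \<pi>\<^sub>R a = \<pi>\<^sub>S b \<and> r = a \<otimes>\<^bsub>R\<^esub> \<delta>\<^sub>R \<and> s = \<ominus>\<^bsub>S\<^esub> (b \<otimes>\<^bsub>S\<^esub> \<delta>\<^sub>S))"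
begin

text \<open>In the description of the kernel, replace \<open>(a, b)\<close> by \<open>(- a, - b)\<close>.\<close>

lemma swap: "connected_sum_presentation Q S R k \<pi>\<^sub>S \<delta>\<^sub>S \<pi>\<^sub>R \<delta>\<^sub>R (\<lambda>s r. g r s)"
proof unfold_locales
  fix s r assume sr: "s \<in> carrier S" "r \<in> carrier R" "\<pi>\<^sub>S s = \<pi>\<^sub>R r"
  show "g r s = \<zero>\<^bsub>Q\<^esub> \<longleftrightarrow>
      (\<exists>b\<in>carrier S. \<exists>a\<in>carrier R. \<pi>\<^sub>S b = \<pi>\<^sub>R a \<and> s = b \<otimes>\<^bsub>S\<^esub> \<delta>\<^sub>S \<and> r = \<ominus>\<^bsub>R\<^esub> (a \<otimes>\<^bsub>R\<^esub> \<delta>\<^sub>R))"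
    (is "_ \<longleftrightarrow> ?rhs")
  proof
    assume "g r s = \<zero>\<^bsub>Q\<^esub>"
    then obtain a b where ab: "a \<in> carrier R" "b \<in> carrier S" "\<pi>\<^sub>R a = \<pi>\<^sub>S b"
      "r = a \<otimes>\<^bsub>R\<^esub> \<delta>\<^sub>R" "s = \<ominus>\<^bsub>S\<^esub> (b \<otimes>\<^bsub>S\<^esub> \<delta>\<^sub>S)"
      using g_zero_iff sr by auto
    show ?rhs
      by (rule bexI[of _ "\<ominus>\<^bsub>S\<^esub> b"], rule bexI[of _ "\<ominus>\<^bsub>R\<^esub> a"])
        (use ab R.\<delta>_closed S.\<delta>_closed in \<open>simp_all add: R.l_minus S.l_minus\<close>)
  next
    assume ?rhs
    then obtain a b where ab: "a \<in> carrier R" "b \<in> carrier S" "\<pi>\<^sub>S b = \<pi>\<^sub>R a"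
      "r = \<ominus>\<^bsub>R\<^esub> (a \<otimes>\<^bsub>R\<^esub> \<delta>\<^sub>R)" "s = b \<otimes>\<^bsub>S\<^esub> \<delta>\<^sub>S" by blast
    have "\<exists>a\<in>carrier R. \<exists>b\<in>carrier S. \<pi>\<^sub>R a = \<pi>\<^sub>S b \<and> r = a \<otimes>\<^bsub>R\<^esub> \<delta>\<^sub>R \<and> s = \<ominus>\<^bsub>S\<^esub> (b \<otimes>\<^bsub>S\<^esub> \<delta>\<^sub>S)"
      by (rule bexI[of _ "\<ominus>\<^bsub>R\<^esub> a"], rule bexI[of _ "\<ominus>\<^bsub>S\<^esub> b"])
        (use ab R.\<delta>_closed S.\<delta>_closed in \<open>simp_all add: R.l_minus S.l_minus\<close>)
    then show "g r s = \<zero>\<^bsub>Q\<^esub>" using g_zero_iff sr by simp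
  qed
next
  fix q assume "q \<in> carrier Q"
  then show "\<exists>s\<in>carrier S. \<exists>r\<in>carrier R. \<pi>\<^sub>S s = \<pi>\<^sub>R r \<and> q = g r s" using g_surj by metis
qed (auto simp: g_closed g_add g_mult g_one)

lemma compatible_max_ideal_iff:
  assumes "r \<in> carrier R" "s \<in> carrier S" "\<pi>\<^sub>R r = \<pi>\<^sub>S s"
  shows "r \<in> max_ideal R \<longleftrightarrow> s \<in> max_ideal S"
  using R.\<pi>_zero_iff[OF assms(1)] S.\<pi>_zero_iff[OF assms(2)] assms(3) by simp

lemma left_closed: "r \<in> max_ideal R \<Longrightarrow> r \<in> carrier R \<and> \<zero>\<^bsub>S\<^esub> \<in> carrier S \<and> \<pi>\<^sub>R r = \<pi>\<^sub>S \<zero>\<^bsub>S\<^esub>"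
  using R.\<pi>_zero_iff[of r] R.maxi.Icarr[of r] by simp

lemma right_closed: "s \<in> max_ideal S \<Longrightarrow> \<zero>\<^bsub>R\<^esub> \<in> carrier R \<and> s \<in> carrier S \<and> \<pi>\<^sub>R \<zero>\<^bsub>R\<^esub> = \<pi>\<^sub>S s"
  using S.\<pi>_zero_iff[of s] S.maxi.Icarr[of s] by simp

lemma g_zero: "g \<zero>\<^bsub>R\<^esub> \<zero>\<^bsub>S\<^esub> = \<zero>\<^bsub>Q\<^esub>"
proof -
  have "g \<zero>\<^bsub>R\<^esub> \<zero>\<^bsub>S\<^esub> \<oplus>\<^bsub>Q\<^esub> g \<zero>\<^bsub>R\<^esub> \<zero>\<^bsub>S\<^esub> = g \<zero>\<^bsub>R\<^esub> \<zero>\<^bsub>S\<^esub>"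
    using g_add[of "\<zero>\<^bsub>R\<^esub>" "\<zero>\<^bsub>S\<^esub>" "\<zero>\<^bsub>R\<^esub>" "\<zero>\<^bsub>S\<^esub>"] by simp
  then show ?thesis using g_closed[of "\<zero>\<^bsub>R\<^esub>" "\<zero>\<^bsub>S\<^esub>"] by (simp add: Q.add.l_cancel_one')
qed

text \<open>A pair of units is a unit of the fibre product, since the two inverses have equal residues.  Conversely,
the kernel of \<open>g\<close> is contained in the product of the maximal ideals because \<open>\<delta>\<^sub>R\<close> and \<open>\<delta>\<^sub>S\<close> are not
units, so \<open>g\<close> maps nonunits to nonunits.\<close>

lemma g_in_max_ideal_iff:
  assumes rs: "r \<in> carrier R" "s \<in> carrier S" "\<pi>\<^sub>R r = \<pi>\<^sub>S s"
  shows "g r s \<in> max_ideal Q \<longleftrightarrow> r \<in> max_ideal R"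
proof
  assume "g r s \<in> max_ideal Q"
  show "r \<in> max_ideal R"
  proof (rule ccontr)
    assume r: "r \<notin> max_ideal R"
    then have s: "s \<notin> max_ideal S" using compatible_max_ideal_iff[OF rs] by simp
    have ur: "r \<in> Units R" and us: "s \<in> Units S" using r s rs R.Units_iff S.Units_iff by auto
    have 1: "\<pi>\<^sub>R (inv\<^bsub>R\<^esub> r) \<otimes>\<^bsub>k\<^esub> \<pi>\<^sub>R r = \<one>\<^bsub>k\<^esub>"
      using R.\<pi>.hom_mult[of "inv\<^bsub>R\<^esub> r" r] ur rs R.\<pi>.hom_one by simp
    have 2: "\<pi>\<^sub>R r \<otimes>\<^bsub>k\<^esub> \<pi>\<^sub>S (inv\<^bsub>S\<^esub> s) = \<one>\<^bsub>k\<^esub>"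
      using S.\<pi>.hom_mult[of s "inv\<^bsub>S\<^esub> s"] us rs S.\<pi>.hom_one by simp
    have eq: "\<pi>\<^sub>R (inv\<^bsub>R\<^esub> r) = \<pi>\<^sub>S (inv\<^bsub>S\<^esub> s)"
      by (rule R.k.inv_unique[OF 1 2]) (use ur us rs in auto)
    have "g (r \<otimes>\<^bsub>R\<^esub> inv\<^bsub>R\<^esub> r) (s \<otimes>\<^bsub>S\<^esub> inv\<^bsub>S\<^esub> s) = g r s \<otimes>\<^bsub>Q\<^esub> g (inv\<^bsub>R\<^esub> r) (inv\<^bsub>S\<^esub> s)"
      by (rule g_mult) (use ur us rs eq in auto)
    then have "g r s \<otimes>\<^bsub>Q\<^esub> g (inv\<^bsub>R\<^esub> r) (inv\<^bsub>S\<^esub> s) = \<one>\<^bsub>Q\<^esub>" using ur us g_one by simp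
    moreover have "g (inv\<^bsub>R\<^esub> r) (inv\<^bsub>S\<^esub> s) \<in> carrier Q" using ur us eq by (intro g_closed) auto
    ultimately show False
      using \<open>g r s \<in> max_ideal Q\<close> Q.maxi.I_r_closed Q.one_notin_max_ideal by metis
  qed
next
  assume r: "r \<in> max_ideal R"
  show "g r s \<in> max_ideal Q"
  proof (rule ccontr)
    assume "g r s \<notin> max_ideal Q"
    then have "g r s \<in> Units Q" using Q.Units_iff g_closed[OF rs] by simp
    then obtain q where "q \<in> carrier Q" "g r s \<otimes>\<^bsub>Q\<^esub> q = \<one>\<^bsub>Q\<^esub>" by (meson Q.Units_inv_closed Q.Units_r_inv)
    then obtain r' s' where rs': "r' \<in> carrier R" "s' \<in> carrier S" "\<pi>\<^sub>R r' = \<pi>\<^sub>S s'"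
      and one: "g r s \<otimes>\<^bsub>Q\<^esub> g r' s' = \<one>\<^bsub>Q\<^esub>" using g_surj by blast
    define u v where "u = r \<otimes>\<^bsub>R\<^esub> r'" and "v = s \<otimes>\<^bsub>S\<^esub> s'"
    have uv: "u \<in> carrier R" "v \<in> carrier S" "\<pi>\<^sub>R u = \<pi>\<^sub>S v" "g u v = \<one>\<^bsub>Q\<^esub>"
      using rs rs' one by (simp_all add: u_def v_def g_mult)
    have compat: "\<ominus>\<^bsub>R\<^esub> \<one>\<^bsub>R\<^esub> \<in> carrier R" "\<ominus>\<^bsub>S\<^esub> \<one>\<^bsub>S\<^esub> \<in> carrier S" "\<pi>\<^sub>R (\<ominus>\<^bsub>R\<^esub> \<one>\<^bsub>R\<^esub>) = \<pi>\<^sub>S (\<ominus>\<^bsub>S\<^esub> \<one>\<^bsub>S\<^esub>)"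
      by simp_all
    have "g (u \<oplus>\<^bsub>R\<^esub> \<ominus>\<^bsub>R\<^esub> \<one>\<^bsub>R\<^esub>) (v \<oplus>\<^bsub>S\<^esub> \<ominus>\<^bsub>S\<^esub> \<one>\<^bsub>S\<^esub>) = g u v \<oplus>\<^bsub>Q\<^esub> g (\<ominus>\<^bsub>R\<^esub> \<one>\<^bsub>R\<^esub>) (\<ominus>\<^bsub>S\<^esub> \<one>\<^bsub>S\<^esub>)"
      by (rule g_add[OF uv(1-3) compat])
    also have "\<dots> = g (\<one>\<^bsub>R\<^esub> \<oplus>\<^bsub>R\<^esub> \<ominus>\<^bsub>R\<^esub> \<one>\<^bsub>R\<^esub>) (\<one>\<^bsub>S\<^esub> \<oplus>\<^bsub>S\<^esub> \<ominus>\<^bsub>S\<^esub> \<one>\<^bsub>S\<^esub>)"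
      using g_add[OF _ _ _ compat, of "\<one>\<^bsub>R\<^esub>" "\<one>\<^bsub>S\<^esub>"] uv(4) g_one by simp
    also have "\<dots> = \<zero>\<^bsub>Q\<^esub>" using g_zero by (simp add: R.r_neg S.r_neg)
    finally have "\<exists>a\<in>carrier R. u \<oplus>\<^bsub>R\<^esub> \<ominus>\<^bsub>R\<^esub> \<one>\<^bsub>R\<^esub> = a \<otimes>\<^bsub>R\<^esub> \<delta>\<^sub>R"
      using g_zero_iff[of "u \<oplus>\<^bsub>R\<^esub> \<ominus>\<^bsub>R\<^esub> \<one>\<^bsub>R\<^esub>" "v \<oplus>\<^bsub>S\<^esub> \<ominus>\<^bsub>S\<^esub> \<one>\<^bsub>S\<^esub>"] uv by auto
    then have "u \<oplus>\<^bsub>R\<^esub> \<ominus>\<^bsub>R\<^esub> \<one>\<^bsub>R\<^esub> \<in> max_ideal R" using R.\<delta>_in_max_ideal R.maxi.I_l_closed by auto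
    moreover have "u \<in> max_ideal R" unfolding u_def using r rs'(1) by (rule R.maxi.I_r_closed)
    ultimately have "u \<oplus>\<^bsub>R\<^esub> \<ominus>\<^bsub>R\<^esub> (u \<oplus>\<^bsub>R\<^esub> \<ominus>\<^bsub>R\<^esub> \<one>\<^bsub>R\<^esub>) \<in> max_ideal R" by simp
    moreover have "u \<oplus>\<^bsub>R\<^esub> \<ominus>\<^bsub>R\<^esub> (u \<oplus>\<^bsub>R\<^esub> \<ominus>\<^bsub>R\<^esub> \<one>\<^bsub>R\<^esub>) = \<one>\<^bsub>R\<^esub>" using uv(1) by (simp add: R.minus_add R.a_assoc[symmetric] R.r_neg)
    ultimately show False using R.one_notin_max_ideal by simp
  qed
qed

text \<open>The images in \<open>Q\<close> of the ideals \<open>\<mm>\<^sub>R \<times> 0\<close> and \<open>0 \<times> \<mm>\<^sub>S\<close> of the fibre product.\<close>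

abbreviation "left_part \<equiv> (\<lambda>r. g r \<zero>\<^bsub>S\<^esub>) ` max_ideal R"
abbreviation "right_part \<equiv> (\<lambda>s. g \<zero>\<^bsub>R\<^esub> s) ` max_ideal S"

lemma parts_subset: "left_part \<subseteq> max_ideal Q" "right_part \<subseteq> max_ideal Q"
  using g_in_max_ideal_iff left_closed right_closed R.maxi.zero_closed by auto

lemma parts_orthogonal: "x \<in> left_part \<Longrightarrow> y \<in> right_part \<Longrightarrow> x \<otimes>\<^bsub>Q\<^esub> y = \<zero>\<^bsub>Q\<^esub>"
proof -
  assume "x \<in> left_part" "y \<in> right_part"
  then obtain r s where rs: "r \<in> max_ideal R" "s \<in> max_ideal S" "x = g r \<zero>\<^bsub>S\<^esub>" "y = g \<zero>\<^bsub>R\<^esub> s" by blast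
  then have "x \<otimes>\<^bsub>Q\<^esub> y = g (r \<otimes>\<^bsub>R\<^esub> \<zero>\<^bsub>R\<^esub>) (\<zero>\<^bsub>S\<^esub> \<otimes>\<^bsub>S\<^esub> s)"
    using left_closed[OF rs(1)] right_closed[OF rs(2)] by (simp add: g_mult del: R.r_null S.l_null)
  then show ?thesis using left_closed[OF rs(1)] right_closed[OF rs(2)] g_zero by simp
qed

lemma parts_generate: "Idl\<^bsub>Q\<^esub> (left_part \<union> right_part) = max_ideal Q"
proof
  show "Idl\<^bsub>Q\<^esub> (left_part \<union> right_part) \<subseteq> max_ideal Q"
    using parts_subset by (intro Q.genideal_minimal Q.maxi.is_ideal) auto
  have carr: "left_part \<union> right_part \<subseteq> carrier Q" using parts_subset Q.maxi.Icarr by blast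
  have id: "ideal (Idl\<^bsub>Q\<^esub> (left_part \<union> right_part)) Q" by (rule Q.genideal_ideal[OF carr])
  show "max_ideal Q \<subseteq> Idl\<^bsub>Q\<^esub> (left_part \<union> right_part)"
  proof
    fix q assume q: "q \<in> max_ideal Q"
    then obtain r s where rs: "r \<in> carrier R" "s \<in> carrier S" "\<pi>\<^sub>R r = \<pi>\<^sub>S s" "q = g r s"
      using g_surj Q.maxi.Icarr by blast
    then have r: "r \<in> max_ideal R" using q g_in_max_ideal_iff by blast
    then have s: "s \<in> max_ideal S" using compatible_max_ideal_iff rs by blast
    have "q = g (r \<oplus>\<^bsub>R\<^esub> \<zero>\<^bsub>R\<^esub>) (\<zero>\<^bsub>S\<^esub> \<oplus>\<^bsub>S\<^esub> s)" using rs by simp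
    also have "\<dots> = g r \<zero>\<^bsub>S\<^esub> \<oplus>\<^bsub>Q\<^esub> g \<zero>\<^bsub>R\<^esub> s" using left_closed[OF r] right_closed[OF s] by (intro g_add) auto
    also have "\<dots> \<in> Idl\<^bsub>Q\<^esub> (left_part \<union> right_part)"
      using Q.genideal_self[OF carr] r s
      by (intro additive_subgroup.a_closed[OF ideal.axioms(1)[OF id]]) auto
    finally show "q \<in> Idl\<^bsub>Q\<^esub> (left_part \<union> right_part)" .
  qed
qed

text \<open>The kernel of \<open>g\<close> meets \<open>R \<times> 0\<close> trivially: if \<open>b \<delta>\<^sub>S = 0\<close>, then \<open>b\<close> is not a unit, so \<open>a\<close> is not a unit
either and \<open>a \<delta>\<^sub>R = 0\<close>.\<close>

lemma left_part_square_nonzero: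
  assumes "a \<in> max_ideal R" "a' \<in> max_ideal R" "a \<otimes>\<^bsub>R\<^esub> a' \<noteq> \<zero>\<^bsub>R\<^esub>"
  shows "\<exists>x\<in>left_part. \<exists>x'\<in>left_part. x \<otimes>\<^bsub>Q\<^esub> x' \<noteq> \<zero>\<^bsub>Q\<^esub>"
proof -
  have "g a \<zero>\<^bsub>S\<^esub> \<otimes>\<^bsub>Q\<^esub> g a' \<zero>\<^bsub>S\<^esub> \<noteq> \<zero>\<^bsub>Q\<^esub>"
  proof
    assume "g a \<zero>\<^bsub>S\<^esub> \<otimes>\<^bsub>Q\<^esub> g a' \<zero>\<^bsub>S\<^esub> = \<zero>\<^bsub>Q\<^esub>"
    then have "g (a \<otimes>\<^bsub>R\<^esub> a') (\<zero>\<^bsub>S\<^esub> \<otimes>\<^bsub>S\<^esub> \<zero>\<^bsub>S\<^esub>) = \<zero>\<^bsub>Q\<^esub>"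
      using left_closed[OF assms(1)] left_closed[OF assms(2)] by (simp add: g_mult del: S.l_null S.r_null)
    then have "g (a \<otimes>\<^bsub>R\<^esub> a') \<zero>\<^bsub>S\<^esub> = \<zero>\<^bsub>Q\<^esub>" by simp
    moreover have "a \<otimes>\<^bsub>R\<^esub> a' \<in> max_ideal R" using assms R.maxi.I_r_closed R.maxi.Icarr by simp
    ultimately obtain c d where cd: "c \<in> carrier R" "d \<in> carrier S" "\<pi>\<^sub>R c = \<pi>\<^sub>S d"
      "a \<otimes>\<^bsub>R\<^esub> a' = c \<otimes>\<^bsub>R\<^esub> \<delta>\<^sub>R" "\<zero>\<^bsub>S\<^esub> = \<ominus>\<^bsub>S\<^esub> (d \<otimes>\<^bsub>S\<^esub> \<delta>\<^sub>S)"
      using g_zero_iff left_closed by blast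
    have "d \<otimes>\<^bsub>S\<^esub> \<delta>\<^sub>S = \<ominus>\<^bsub>S\<^esub> \<zero>\<^bsub>S\<^esub>" unfolding cd(5) using cd(2) S.\<delta>_closed by simp
    then have "d \<in> max_ideal S" using S.mult_\<delta>_eq_zero_iff cd(2) by simp
    then have "c \<in> max_ideal R" using compatible_max_ideal_iff cd by blast
    then show False using R.max_ideal_mult_\<delta> cd(4) assms(3) by simp
  qed
  then show ?thesis using assms(1,2) by blast
qed

text \<open>The square of \<open>\<mm>\<^sub>R\<close> is zero, so \<open>\<mm>\<^sub>R\<close> is the socle of \<open>R\<close>.  The map \<open>s \<mapsto> (\<sigma>(\<pi>\<^sub>S s), s)\<close> from \<open>S\<close> to the
fibre product meets the kernel of \<open>g\<close> trivially.  Its image represents all of \<open>Q\<close>: in a pair \<open>(r, s)\<close>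
the entry \<open>r\<close> differs from \<open>\<sigma>(\<pi>\<^sub>S s)\<close> by a multiple of \<open>\<delta>\<^sub>R\<close>, and adding an element of the kernel
corrects \<open>r\<close> while it changes \<open>s\<close> only by a multiple of \<open>\<delta>\<^sub>S\<close>, which has residue zero.\<close>

lemma iso_if_square_zero:
  assumes sq: "\<And>a b. a \<in> max_ideal R \<Longrightarrow> b \<in> max_ideal R \<Longrightarrow> a \<otimes>\<^bsub>R\<^esub> b = \<zero>\<^bsub>R\<^esub>"
    and \<sigma>: "\<sigma> \<in> ring_hom k R" "\<And>c. c \<in> carrier k \<Longrightarrow> \<pi>\<^sub>R (\<sigma> c) = c"
  shows "S \<simeq> Q"
proof -
  interpret \<sigma>: ring_hom_ring k R \<sigma> using \<sigma>(1) by (intro ring_hom_ringI2 R.k.ring_axioms R.ring_axioms)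
  let ?f = "\<lambda>s. g (\<sigma> (\<pi>\<^sub>S s)) s"
  have compat: "\<sigma> (\<pi>\<^sub>S s) \<in> carrier R" "\<pi>\<^sub>R (\<sigma> (\<pi>\<^sub>S s)) = \<pi>\<^sub>S s" if "s \<in> carrier S" for s
    using that \<sigma>(2) by simp_all
  have kernel: "s = \<zero>\<^bsub>S\<^esub>" if s: "s \<in> carrier S" "?f s = \<zero>\<^bsub>Q\<^esub>" for s
  proof -
    obtain a b where ab: "a \<in> carrier R" "b \<in> carrier S" "\<pi>\<^sub>R a = \<pi>\<^sub>S b"
      "\<sigma> (\<pi>\<^sub>S s) = a \<otimes>\<^bsub>R\<^esub> \<delta>\<^sub>R" "s = \<ominus>\<^bsub>S\<^esub> (b \<otimes>\<^bsub>S\<^esub> \<delta>\<^sub>S)"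
      using g_zero_iff[OF compat(1)[OF s(1)] s(1) compat(2)[OF s(1)]] s(2) by auto
    have "\<sigma> (\<pi>\<^sub>S s) \<in> max_ideal R" unfolding ab(4) using R.\<delta>_in_max_ideal ab(1) by (rule R.maxi.I_l_closed)
    then have "\<pi>\<^sub>S s = \<zero>\<^bsub>k\<^esub>" using R.\<pi>_zero_iff[OF compat(1)[OF s(1)]] compat(2)[OF s(1)] by simp
    then have "a \<otimes>\<^bsub>R\<^esub> \<delta>\<^sub>R = \<zero>\<^bsub>R\<^esub>" using ab(4) by simp
    then have "a \<in> max_ideal R" using R.mult_\<delta>_eq_zero_iff ab(1) by simp
    then have "b \<in> max_ideal S" using compatible_max_ideal_iff ab by blast
    then show ?thesis using ab(5) S.max_ideal_mult_\<delta> by simp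
  qed
  have hom: "?f \<in> ring_hom S Q"
  proof (rule ring_hom_memI)
    fix s t assume st: "s \<in> carrier S" "t \<in> carrier S"
    show "?f s \<in> carrier Q" using g_closed[OF compat(1)[OF st(1)] st(1) compat(2)[OF st(1)]] .
    show "?f (s \<oplus>\<^bsub>S\<^esub> t) = ?f s \<oplus>\<^bsub>Q\<^esub> ?f t"
      using g_add[OF compat(1)[OF st(1)] st(1) compat(2)[OF st(1)] compat(1)[OF st(2)] st(2) compat(2)[OF st(2)]] st
      by simp
    show "?f (s \<otimes>\<^bsub>S\<^esub> t) = ?f s \<otimes>\<^bsub>Q\<^esub> ?f t"
      using g_mult[OF compat(1)[OF st(1)] st(1) compat(2)[OF st(1)] compat(1)[OF st(2)] st(2) compat(2)[OF st(2)]] st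
      by simp
  qed (simp add: g_one)
  interpret f: ring_hom_ring S Q ?f by (rule ring_hom_ringI2[OF S.ring_axioms Q.ring_axioms hom])
  have "a_kernel S Q ?f \<subseteq> {\<zero>\<^bsub>S\<^esub>}" unfolding a_kernel_def' using kernel by blast
  moreover have "\<zero>\<^bsub>S\<^esub> \<in> a_kernel S Q ?f" unfolding a_kernel_def' using f.hom_zero S.zero_closed by blast
  ultimately have "inj_on ?f (carrier S)" by (intro f.trivial_ker_imp_inj subset_antisym) simp_all
  moreover have "carrier Q \<subseteq> ?f ` carrier S"
  proof
    fix q assume "q \<in> carrier Q"
    then obtain r s where rs: "r \<in> carrier R" "s \<in> carrier S" "\<pi>\<^sub>R r = \<pi>\<^sub>S s" "q = g r s" using g_surj by blast
    let ?t = "\<sigma> (\<pi>\<^sub>S s)"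
    have t: "?t \<in> carrier R" "\<pi>\<^sub>R ?t = \<pi>\<^sub>S s" using compat[OF rs(2)] by auto
    have "?t \<ominus>\<^bsub>R\<^esub> r \<in> max_ideal R" using R.\<pi>_eq_iff[OF t(1) rs(1)] t rs by simp
    then obtain a where a: "a \<in> carrier R" "?t \<ominus>\<^bsub>R\<^esub> r = a \<otimes>\<^bsub>R\<^esub> \<delta>\<^sub>R"
      using R.max_ideal_subset_socle sq by metis
    obtain b where b: "b \<in> carrier S" "\<pi>\<^sub>R a = \<pi>\<^sub>S b"
      using S.\<pi>_surj R.\<pi>.hom_closed[OF a(1)] by (metis imageE)
    let ?n = "\<ominus>\<^bsub>S\<^esub> (b \<otimes>\<^bsub>S\<^esub> \<delta>\<^sub>S)"
    have n: "?n \<in> max_ideal S" using b(1) S.\<delta>_in_max_ideal S.maxi.I_l_closed by simp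
    have nc: "?n \<in> carrier S" "\<pi>\<^sub>S ?n = \<zero>\<^bsub>k\<^esub>" using n S.maxi.Icarr S.\<pi>_zero_iff by blast+
    have "a \<otimes>\<^bsub>R\<^esub> \<delta>\<^sub>R \<in> max_ideal R" using R.\<delta>_in_max_ideal a(1) by (rule R.maxi.I_l_closed)
    then have dc: "a \<otimes>\<^bsub>R\<^esub> \<delta>\<^sub>R \<in> carrier R" "\<pi>\<^sub>R (a \<otimes>\<^bsub>R\<^esub> \<delta>\<^sub>R) = \<zero>\<^bsub>k\<^esub>"
      using R.\<pi>_zero_iff R.maxi.Icarr by blast+
    have z: "g (a \<otimes>\<^bsub>R\<^esub> \<delta>\<^sub>R) ?n = \<zero>\<^bsub>Q\<^esub>" using g_zero_iff[OF dc(1) nc(1)] dc nc a(1) b by auto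
    have "g (r \<oplus>\<^bsub>R\<^esub> a \<otimes>\<^bsub>R\<^esub> \<delta>\<^sub>R) (s \<oplus>\<^bsub>S\<^esub> ?n) = q \<oplus>\<^bsub>Q\<^esub> \<zero>\<^bsub>Q\<^esub>"
      unfolding z[symmetric] rs(4) using rs dc nc by (intro g_add) auto
    also have "\<dots> = q" using \<open>q \<in> carrier Q\<close> by simp
    finally have "q = g (r \<oplus>\<^bsub>R\<^esub> a \<otimes>\<^bsub>R\<^esub> \<delta>\<^sub>R) (s \<oplus>\<^bsub>S\<^esub> ?n)" by simp
    also have "r \<oplus>\<^bsub>R\<^esub> a \<otimes>\<^bsub>R\<^esub> \<delta>\<^sub>R = ?t" unfolding a(2)[symmetric] using rs(1) t(1) by algebra
    also have "?t = \<sigma> (\<pi>\<^sub>S (s \<oplus>\<^bsub>S\<^esub> ?n))" using S.\<pi>.hom_add[OF rs(2) nc(1)] nc rs(2) by simp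
    finally show "q \<in> ?f ` carrier S" using rs(2) nc(1) by blast
  qed
  ultimately have "?f \<in> ring_iso S Q" using hom f.hom_closed unfolding ring_iso_def bij_betw_def by blast
  then show ?thesis unfolding is_ring_iso_def by blast
qed

lemma square_nonzero_if_nondegenerate:
  assumes "nondegenerate_component R k \<pi>\<^sub>R" "\<not> S \<simeq> Q"
  shows "\<exists>a\<in>max_ideal R. \<exists>a'\<in>max_ideal R. a \<otimes>\<^bsub>R\<^esub> a' \<noteq> \<zero>\<^bsub>R\<^esub>"
proof (rule ccontr)
  assume "\<not> ?thesis"
  then have sq: "a \<otimes>\<^bsub>R\<^esub> b = \<zero>\<^bsub>R\<^esub>" if "a \<in> max_ideal R" "b \<in> max_ideal R" for a b using that by blast
  have "max_ideal_power R 2 = {\<zero>\<^bsub>R\<^esub>}" by (rule R.max_ideal_power_2[OF sq])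
  then obtain \<sigma> where "\<sigma> \<in> ring_hom k R" "\<And>c. c \<in> carrier k \<Longrightarrow> \<pi>\<^sub>R (\<sigma> c) = c"
    using assms(1) unfolding nondegenerate_component_def by blast
  then show False using iso_if_square_zero[OF sq] assms(2) by blast
qed

end

section \<open>Presenting a quotient of a fibre product\<close>

lemma fibre_product_simps:
  "carrier (fibre_product R S \<pi>\<^sub>R \<pi>\<^sub>S) = {(r, s). r \<in> carrier R \<and> s \<in> carrier S \<and> \<pi>\<^sub>R r = \<pi>\<^sub>S s}"
  "(r, s) \<otimes>\<^bsub>fibre_product R S \<pi>\<^sub>R \<pi>\<^sub>S\<^esub> (r', s') = (r \<otimes>\<^bsub>R\<^esub> r', s \<otimes>\<^bsub>S\<^esub> s')"
  "(r, s) \<oplus>\<^bsub>fibre_product R S \<pi>\<^sub>R \<pi>\<^sub>S\<^esub> (r', s') = (r \<oplus>\<^bsub>R\<^esub> r', s \<oplus>\<^bsub>S\<^esub> s')"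
  "\<one>\<^bsub>fibre_product R S \<pi>\<^sub>R \<pi>\<^sub>S\<^esub> = (\<one>\<^bsub>R\<^esub>, \<one>\<^bsub>S\<^esub>)"
  "\<zero>\<^bsub>fibre_product R S \<pi>\<^sub>R \<pi>\<^sub>S\<^esub> = (\<zero>\<^bsub>R\<^esub>, \<zero>\<^bsub>S\<^esub>)"
  by (simp_all add: fibre_product_def RDirProd_def DirProd_def monoid.defs)

lemma fibre_product_cring:
  assumes "cring R" "cring S" "ring k" "\<pi>\<^sub>R \<in> ring_hom R k" "\<pi>\<^sub>S \<in> ring_hom S k"
  shows "cring (fibre_product R S \<pi>\<^sub>R \<pi>\<^sub>S)"
proof -
  interpret R: cring R by fact
  interpret S: cring S by fact
  interpret k: ring k by fact
  interpret r: ring_hom_ring R k \<pi>\<^sub>R using assms by (intro ring_hom_ringI2 R.ring_axioms)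
  interpret s: ring_hom_ring S k \<pi>\<^sub>S using assms by (intro ring_hom_ringI2 S.ring_axioms)
  note simps = fibre_product_simps
  show ?thesis
  proof (rule cringI)
    show "abelian_group (fibre_product R S \<pi>\<^sub>R \<pi>\<^sub>S)"
    proof (rule abelian_groupI)
      fix x assume "x \<in> carrier (fibre_product R S \<pi>\<^sub>R \<pi>\<^sub>S)"
      then obtain r s where rs: "x = (r, s)" "r \<in> carrier R" "s \<in> carrier S" "\<pi>\<^sub>R r = \<pi>\<^sub>S s"
        by (auto simp: simps)
      show "\<exists>y\<in>carrier (fibre_product R S \<pi>\<^sub>R \<pi>\<^sub>S). y \<oplus>\<^bsub>fibre_product R S \<pi>\<^sub>R \<pi>\<^sub>S\<^esub> x = \<zero>\<^bsub>fibre_product R S \<pi>\<^sub>R \<pi>\<^sub>S\<^esub>"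
        by (rule bexI[of _ "(\<ominus>\<^bsub>R\<^esub> r, \<ominus>\<^bsub>S\<^esub> s)"]) (use rs in \<open>auto simp: simps R.l_neg S.l_neg\<close>)
    next
      fix x y assume "x \<in> carrier (fibre_product R S \<pi>\<^sub>R \<pi>\<^sub>S)" "y \<in> carrier (fibre_product R S \<pi>\<^sub>R \<pi>\<^sub>S)"
      then show "x \<oplus>\<^bsub>fibre_product R S \<pi>\<^sub>R \<pi>\<^sub>S\<^esub> y = y \<oplus>\<^bsub>fibre_product R S \<pi>\<^sub>R \<pi>\<^sub>S\<^esub> x"
        by (auto simp: simps R.a_comm S.a_comm)
    qed (auto simp: simps R.a_assoc S.a_assoc)
    show "comm_monoid (fibre_product R S \<pi>\<^sub>R \<pi>\<^sub>S)"
    proof (rule comm_monoidI)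
      fix x y assume "x \<in> carrier (fibre_product R S \<pi>\<^sub>R \<pi>\<^sub>S)" "y \<in> carrier (fibre_product R S \<pi>\<^sub>R \<pi>\<^sub>S)"
      then show "x \<otimes>\<^bsub>fibre_product R S \<pi>\<^sub>R \<pi>\<^sub>S\<^esub> y = y \<otimes>\<^bsub>fibre_product R S \<pi>\<^sub>R \<pi>\<^sub>S\<^esub> x"
        by (auto simp: simps R.m_comm S.m_comm)
    qed (auto simp: simps R.m_assoc S.m_assoc)
  qed (auto simp: simps R.l_distr S.l_distr)
qed

lemma connected_sum_presentation_exists:
  assumes Q: "local_cring Q" and "component R k \<pi>\<^sub>R \<delta>\<^sub>R" "component S k \<pi>\<^sub>S \<delta>\<^sub>S"
    and iso: "Q \<simeq> connected_sum R S \<pi>\<^sub>R \<pi>\<^sub>S \<delta>\<^sub>R \<delta>\<^sub>S"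
  obtains g where "connected_sum_presentation Q R S k \<pi>\<^sub>R \<delta>\<^sub>R \<pi>\<^sub>S \<delta>\<^sub>S g"
proof -
  interpret Q: local_cring Q by fact
  interpret R: component R k \<pi>\<^sub>R \<delta>\<^sub>R by fact
  interpret S: component S k \<pi>\<^sub>S \<delta>\<^sub>S by fact
  define P where "P = fibre_product R S \<pi>\<^sub>R \<pi>\<^sub>S"
  note P_simps = fibre_product_simps[of R S \<pi>\<^sub>R \<pi>\<^sub>S, folded P_def]
  interpret P: cring P unfolding P_def
    by (rule fibre_product_cring[OF R.is_cring S.is_cring R.k.ring_axioms R.\<pi>_hom S.\<pi>_hom])
  have \<delta>\<pi>: "\<pi>\<^sub>R \<delta>\<^sub>R = \<zero>\<^bsub>k\<^esub>" "\<pi>\<^sub>S \<delta>\<^sub>S = \<zero>\<^bsub>k\<^esub>"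
    using R.\<pi>_zero_iff R.\<delta>_closed R.\<delta>_in_max_ideal S.\<pi>_zero_iff S.\<delta>_closed S.\<delta>_in_max_ideal by auto
  have neg: "\<ominus>\<^bsub>P\<^esub> (\<zero>\<^bsub>R\<^esub>, \<delta>\<^sub>S) = (\<zero>\<^bsub>R\<^esub>, \<ominus>\<^bsub>S\<^esub> \<delta>\<^sub>S)"
    by (rule P.minus_equality) (auto simp: P_simps S.\<delta>_closed \<delta>\<pi> S.l_neg)
  define z where "z = (\<delta>\<^sub>R, \<ominus>\<^bsub>S\<^esub> \<delta>\<^sub>S)"
  have z_eq: "(\<delta>\<^sub>R, \<zero>\<^bsub>S\<^esub>) \<ominus>\<^bsub>P\<^esub> (\<zero>\<^bsub>R\<^esub>, \<delta>\<^sub>S) = z"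
    unfolding a_minus_def neg z_def by (simp add: P_simps R.\<delta>_closed S.\<delta>_closed)
  have zc: "z \<in> carrier P" by (simp add: z_def P_simps R.\<delta>_closed S.\<delta>_closed \<delta>\<pi>)
  define K where "K = PIdl\<^bsub>P\<^esub> z"
  interpret K: ideal K P unfolding K_def by (rule P.cgenideal_ideal[OF zc])
  have "connected_sum R S \<pi>\<^sub>R \<pi>\<^sub>S \<delta>\<^sub>R \<delta>\<^sub>S = P Quot K"
    unfolding connected_sum_def Let_def P_def[symmetric] z_eq K_def ..
  then obtain \<phi> where "\<phi> \<in> ring_iso Q (P Quot K)" using iso unfolding is_ring_iso_def by auto
  then have "inv_into (carrier Q) \<phi> \<in> ring_iso (P Quot K) Q" by (rule ring_iso_set_sym[OF Q.ring_axioms])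
  then obtain \<psi> where \<psi>: "\<psi> \<in> ring_iso (P Quot K) Q" by blast
  have \<psi>_hom: "\<psi> \<in> ring_hom (P Quot K) Q" and \<psi>_bij: "bij_betw \<psi> (carrier (P Quot K)) (carrier Q)"
    using \<psi> unfolding ring_iso_def by auto
  define h where "h x = \<psi> (K +>\<^bsub>P\<^esub> x)" for x
  have "h \<in> ring_hom P Q" using ring_hom_trans[OF K.rcos_ring_hom \<psi>_hom] by (simp add: h_def[abs_def] comp_def)
  then interpret h: ring_hom_ring P Q h by (rule ring_hom_ringI2[OF P.ring_axioms Q.ring_axioms])
  interpret \<psi>: ring_hom_ring "P Quot K" Q \<psi>
    by (rule ring_hom_ringI2[OF K.quotient_is_ring Q.ring_axioms \<psi>_hom])
  have carrQ: "carrier (P Quot K) = (\<lambda>x. K +>\<^bsub>P\<^esub> x) ` carrier P"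
    by (auto simp: FactRing_def A_RCOSETS_defs a_r_coset_def)
  have zeroQ: "\<zero>\<^bsub>P Quot K\<^esub> = K" by (simp add: FactRing_def)
  have ker: "h x = \<zero>\<^bsub>Q\<^esub> \<longleftrightarrow> x \<in> K" if x: "x \<in> carrier P" for x
  proof -
    have "h x = \<zero>\<^bsub>Q\<^esub> \<longleftrightarrow> \<psi> (K +>\<^bsub>P\<^esub> x) = \<psi> \<zero>\<^bsub>P Quot K\<^esub>" by (simp add: h_def)
    also have "\<dots> \<longleftrightarrow> K +>\<^bsub>P\<^esub> x = \<zero>\<^bsub>P Quot K\<^esub>"
      using \<psi>_bij x carrQ \<psi>.R.zero_closed unfolding bij_betw_def by (intro inj_on_eq_iff) auto
    also have "\<dots> \<longleftrightarrow> x \<in> K" unfolding zeroQ using x K.rcos_const_imp_mem K.a_rcos_const by blast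
    finally show ?thesis .
  qed
  have mult_z: "(a, b) \<otimes>\<^bsub>P\<^esub> z = (a \<otimes>\<^bsub>R\<^esub> \<delta>\<^sub>R, \<ominus>\<^bsub>S\<^esub> (b \<otimes>\<^bsub>S\<^esub> \<delta>\<^sub>S))" if "b \<in> carrier S" for a b
    using that S.\<delta>_closed by (simp add: z_def P_simps S.r_minus)
  have K_iff: "x \<in> K \<longleftrightarrow> (\<exists>a\<in>carrier R. \<exists>b\<in>carrier S. \<pi>\<^sub>R a = \<pi>\<^sub>S b \<and>
      x = (a \<otimes>\<^bsub>R\<^esub> \<delta>\<^sub>R, \<ominus>\<^bsub>S\<^esub> (b \<otimes>\<^bsub>S\<^esub> \<delta>\<^sub>S)))" (is "_ \<longleftrightarrow> ?rhs") for x
  proof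
    assume "x \<in> K"
    then obtain y where y: "y \<in> carrier P" "x = y \<otimes>\<^bsub>P\<^esub> z" unfolding K_def cgenideal_def by blast
    then obtain a b where ab: "y = (a, b)" "a \<in> carrier R" "b \<in> carrier S" "\<pi>\<^sub>R a = \<pi>\<^sub>S b"
      by (auto simp: P_simps)
    show ?rhs using ab(2-4) y(2) mult_z[OF ab(3)] unfolding ab(1) by blast
  next
    assume ?rhs
    then obtain a b where ab: "a \<in> carrier R" "b \<in> carrier S" "\<pi>\<^sub>R a = \<pi>\<^sub>S b" "x = (a, b) \<otimes>\<^bsub>P\<^esub> z"
      using mult_z by auto
    then have "(a, b) \<in> carrier P" by (simp add: P_simps)
    then show "x \<in> K" unfolding K_def cgenideal_def ab(4) by blast
  qed
  have surj: "h ` carrier P = carrier Q"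
    using \<psi>_bij unfolding bij_betw_def carrQ by (auto simp: h_def[abs_def] image_image)
  have "connected_sum_presentation Q R S k \<pi>\<^sub>R \<delta>\<^sub>R \<pi>\<^sub>S \<delta>\<^sub>S (\<lambda>r s. h (r, s))"
  proof unfold_locales
    show "h (\<one>\<^bsub>R\<^esub>, \<one>\<^bsub>S\<^esub>) = \<one>\<^bsub>Q\<^esub>" using h.hom_one unfolding P_simps .
    fix r s assume rs: "r \<in> carrier R" "s \<in> carrier S" "\<pi>\<^sub>R r = \<pi>\<^sub>S s"
    then have c: "(r, s) \<in> carrier P" by (simp add: P_simps)
    show "h (r, s) \<in> carrier Q" using c by simp
    show "h (r, s) = \<zero>\<^bsub>Q\<^esub> \<longleftrightarrow>
      (\<exists>a\<in>carrier R. \<exists>b\<in>carrier S. \<pi>\<^sub>R a = \<pi>\<^sub>S b \<and> r = a \<otimes>\<^bsub>R\<^esub> \<delta>\<^sub>R \<and> s = \<ominus>\<^bsub>S\<^esub> (b \<otimes>\<^bsub>S\<^esub> \<delta>\<^sub>S))"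
      unfolding ker[OF c] K_iff by simp
    fix r' s' assume "r' \<in> carrier R" "s' \<in> carrier S" "\<pi>\<^sub>R r' = \<pi>\<^sub>S s'"
    then have c': "(r', s') \<in> carrier P" by (simp add: P_simps)
    show "h (r \<oplus>\<^bsub>R\<^esub> r', s \<oplus>\<^bsub>S\<^esub> s') = h (r, s) \<oplus>\<^bsub>Q\<^esub> h (r', s')"
      using h.hom_add[OF c c'] by (simp add: P_simps)
    show "h (r \<otimes>\<^bsub>R\<^esub> r', s \<otimes>\<^bsub>S\<^esub> s') = h (r, s) \<otimes>\<^bsub>Q\<^esub> h (r', s')"
      using h.hom_mult[OF c c'] by (simp add: P_simps)
  next
    fix q assume "q \<in> carrier Q"
    then obtain x where "x \<in> carrier P" "q = h x" using surj by blast
    then show "\<exists>r\<in>carrier R. \<exists>s\<in>carrier S. \<pi>\<^sub>R r = \<pi>\<^sub>S s \<and> q = h (r, s)" by (auto simp: P_simps)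
  qed
  then show thesis by (rule that)
qed

section \<open>Indecomposability\<close>

lemma artinian_local_cring_if_gorenstein:
  "gorenstein_artin_local_ring R \<Longrightarrow> artinian_local_cring R"
  unfolding gorenstein_artin_local_ring_def local_ring_def
  by (intro artinian_local_cring.intro local_cring.intro local_cring_axioms.intro artinian_local_cring_axioms.intro) auto

theorem theorem3p9:
  fixes Q :: "('q, 'l) ring_scheme" and d i :: nat
  assumes "gorenstein_artin_local_ring Q"
    and "edim Q = d"
    and "i \<ge> 2"
    and "hilbert_function Q i \<ge> ((d + i - 2) choose i) + 2"
  shows "indecomposable_as_connected_sum TYPE('a) TYPE('b) Q"
  unfolding indecomposable_as_connected_sum_def
proof
  assume "decomposes_as_connected_sum TYPE('a) TYPE('b) Q"
  then obtain R :: "'a ring" and S :: "'b ring" and \<pi>\<^sub>R \<pi>\<^sub>S where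
    RS: "gorenstein_artin_local_ring R" "gorenstein_artin_local_ring S"
      "residue_projection R (residue_field Q) \<pi>\<^sub>R" "residue_projection S (residue_field Q) \<pi>\<^sub>S"
      "\<not> R \<simeq> residue_field Q" "\<not> S \<simeq> residue_field Q"
      "nondegenerate_component R (residue_field Q) \<pi>\<^sub>R" "nondegenerate_component S (residue_field Q) \<pi>\<^sub>S"
      "is_connected_sum Q R S \<pi>\<^sub>R \<pi>\<^sub>S" "\<not> R \<simeq> Q" "\<not> Q \<simeq> S"
    unfolding decomposes_as_connected_sum_def by blast
  obtain \<delta>\<^sub>R \<delta>\<^sub>S where \<delta>: "\<delta>\<^sub>R \<in> carrier R" "\<delta>\<^sub>S \<in> carrier S"
      "socle R = PIdl\<^bsub>R\<^esub> \<delta>\<^sub>R" "socle S = PIdl\<^bsub>S\<^esub> \<delta>\<^sub>S" "Q \<simeq> connected_sum R S \<pi>\<^sub>R \<pi>\<^sub>S \<delta>\<^sub>R \<delta>\<^sub>S"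
    using RS(9) unfolding is_connected_sum_def by blast
  interpret Q: artinian_local_cring Q by (rule artinian_local_cring_if_gorenstein[OF assms(1)])
  have "component R (residue_field Q) \<pi>\<^sub>R \<delta>\<^sub>R" "component S (residue_field Q) \<pi>\<^sub>S \<delta>\<^sub>S"
    using RS(1-6) \<delta>(1-4) artinian_local_cring_if_gorenstein Q.residue_field_field
    by (auto intro!: component.intro component_axioms.intro)
  then obtain g where "connected_sum_presentation Q R S (residue_field Q) \<pi>\<^sub>R \<delta>\<^sub>R \<pi>\<^sub>S \<delta>\<^sub>S g"
    using connected_sum_presentation_exists[OF Q.local_cring_axioms _ _ \<delta>(5)] by blast
  then interpret g: connected_sum_presentation Q R S "residue_field Q" \<pi>\<^sub>R \<delta>\<^sub>R \<pi>\<^sub>S \<delta>\<^sub>S g .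
  interpret swap: connected_sum_presentation Q S R "residue_field Q" \<pi>\<^sub>S \<delta>\<^sub>S \<pi>\<^sub>R \<delta>\<^sub>R "\<lambda>s r. g r s"
    by (rule g.swap)
  have "\<not> S \<simeq> Q" using ring_iso_sym[OF g.S.ring_axioms] RS(11) by blast
  then have "\<exists>x\<in>g.left_part. \<exists>x'\<in>g.left_part. x \<otimes>\<^bsub>Q\<^esub> x' \<noteq> \<zero>\<^bsub>Q\<^esub>"
    using g.square_nonzero_if_nondegenerate[OF RS(7)] g.left_part_square_nonzero by blast
  moreover have "\<exists>y\<in>g.right_part. \<exists>y'\<in>g.right_part. y \<otimes>\<^bsub>Q\<^esub> y' \<noteq> \<zero>\<^bsub>Q\<^esub>"
    using swap.square_nonzero_if_nondegenerate[OF RS(8,10)] swap.left_part_square_nonzero by blast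
  moreover have "g.left_part \<subseteq> carrier Q" "g.right_part \<subseteq> carrier Q" using g.parts_subset Q.maxi.Icarr by blast+
  ultimately have "hilbert_function Q i \<le> (edim Q + i - 2 choose i) + 1"
    using g.parts_generate g.parts_orthogonal assms(3)
    by (intro Q.hilbert_function_le_if_orthogonal_generators[of g.left_part g.right_part]) auto
  then show False using assms(2,4) by simp
qed

end
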